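(* Let $H \in (0,1)$, $K \in (0,1)$ and $T \in (0,\infty)$, and let $Z_{H,K}$ be a trifractional Brownian motion with parameters $H$ and $K$. Then the following hold. (1) If $HK < 1/2$, then the sequence $$2^{2HKn}\sum_{k = 1}^{2^n}\left(Z_{H,K}\Big(\frac{kT}{2^n}\Big)-Z_{H,K}\Big(\frac{(k-1)T}{2^n}\Big)\right)^2$$ does not converge in probability as $n \to \infty$. (2) If $HK > 1/2$, then the sequence $$2^{n}\sum_{k = 1}^{2^n}\left(Z_{H,K}\Big(\frac{kT}{2^n}\Big)-Z_{H,K}\Big(\frac{(k-1)T}{2^n}\Big)\right)^2$$ converges to some non-constant random variable in $L^p$ for all $p \in (1,\infty)$ as $n \to \infty$.
   Context: A trifractional Brownian motion $Z_{H,K} = \{Z_{H,K}(t), t\in[0,\infty)\}$ with parameters $H\in(0,1)$ and $K\in(0,1)$ is a centered Gaussian process with covariance function $$C_{H,K}(s,t) = t^{2HK} + s^{2HK} - (t^{2H}+s^{2H})^{K}, \qquad s,t\in[0,\infty).$$ A random variable is non-constant if it is not almost surely equal to a constant. *)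

theory Defs
  imports "HOL-Probability.Probability"
begin

text \<open>Point masses count as Gaussian (variance 0); they arise from linear combinations of the
  variables of a Gaussian process, for instance at time 0.\<close>

definition gaussian_rv :: "'a measure \<Rightarrow> ('a \<Rightarrow> real) \<Rightarrow> bool" where
  "gaussian_rv M X \<longleftrightarrow> X \<in> borel_measurable M \<and>
     ((\<exists>\<mu>. AE \<omega> in M. X \<omega> = \<mu>) \<or>
      (\<exists>\<mu> \<sigma>. \<sigma> > 0 \<and> distributed M lborel X (\<lambda>x. ennreal (normal_density \<mu> \<sigma> x))))"

text \<open>All finite-dimensional distributions are multivariate normal, that is, all finite linear
  combinations are (possibly degenerate) normal.\<close>

definition gaussian_process :: "'a measure \<Rightarrow> 'i set \<Rightarrow> ('i \<Rightarrow> 'a \<Rightarrow> real) \<Rightarrow> bool" where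
  "gaussian_process M I X \<longleftrightarrow>
     (\<forall>t\<in>I. X t \<in> borel_measurable M) \<and>
     (\<forall>J c. finite J \<longrightarrow> J \<subseteq> I \<longrightarrow> gaussian_rv M (\<lambda>\<omega>. \<Sum>t\<in>J. c t * X t \<omega>))"

definition covariance :: "'a measure \<Rightarrow> ('a \<Rightarrow> real) \<Rightarrow> ('a \<Rightarrow> real) \<Rightarrow> real" where
  "covariance M X Y =
     (LINT \<omega>|M. (X \<omega> - (LINT \<omega>'|M. X \<omega>')) * (Y \<omega> - (LINT \<omega>'|M. Y \<omega>')))"

definition trifractional_cov :: "real \<Rightarrow> real \<Rightarrow> real \<Rightarrow> real \<Rightarrow> real" where
  "trifractional_cov H K s t =
     t powr (2 * H * K) + s powr (2 * H * K) - (t powr (2 * H) + s powr (2 * H)) powr K"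

definition trifractional_brownian_motion ::
    "'a measure \<Rightarrow> real \<Rightarrow> real \<Rightarrow> (real \<Rightarrow> 'a \<Rightarrow> real) \<Rightarrow> bool" where
  "trifractional_brownian_motion M H K Z \<longleftrightarrow>
     gaussian_process M {0..} Z \<and>
     (\<forall>t\<ge>0. (LINT \<omega>|M. Z t \<omega>) = 0) \<and>
     (\<forall>s\<ge>0. \<forall>t\<ge>0. covariance M (Z s) (Z t) = trifractional_cov H K s t)"

definition converges_in_probability ::
    "'a measure \<Rightarrow> (nat \<Rightarrow> 'a \<Rightarrow> real) \<Rightarrow> ('a \<Rightarrow> real) \<Rightarrow> bool" where
  "converges_in_probability M X L \<longleftrightarrow>
     (\<forall>n. X n \<in> borel_measurable M) \<and> L \<in> borel_measurable M \<and>
     (\<forall>\<epsilon>>0. (\<lambda>n. measure M {\<omega> \<in> space M. \<bar>X n \<omega> - L \<omega>\<bar> > \<epsilon>}) \<longlonglongrightarrow> 0)"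

definition in_Lp :: "'a measure \<Rightarrow> real \<Rightarrow> ('a \<Rightarrow> real) \<Rightarrow> bool" where
  "in_Lp M p X \<longleftrightarrow> X \<in> borel_measurable M \<and> integrable M (\<lambda>\<omega>. \<bar>X \<omega>\<bar> powr p)"

definition converges_in_Lp ::
    "'a measure \<Rightarrow> real \<Rightarrow> (nat \<Rightarrow> 'a \<Rightarrow> real) \<Rightarrow> ('a \<Rightarrow> real) \<Rightarrow> bool" where
  "converges_in_Lp M p X L \<longleftrightarrow>
     (\<forall>n. in_Lp M p (X n)) \<and> in_Lp M p L \<and>
     (\<lambda>n. LINT \<omega>|M. \<bar>X n \<omega> - L \<omega>\<bar> powr p) \<longlonglongrightarrow> 0"

definition non_constant_rv :: "'a measure \<Rightarrow> ('a \<Rightarrow> real) \<Rightarrow> bool" where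
  "non_constant_rv M X \<longleftrightarrow>
     X \<in> borel_measurable M \<and> \<not> (\<exists>c. AE \<omega> in M. X \<omega> = c)"

end

theory Submission
  imports Defs
begin

text \<open>The increment of \<open>Z\<close> over the \<open>k\<close>-th dyadic interval has variance at most of
  order \<open>2^(-2HKn) * k^(2HK-2)\<close>, by concavity of \<open>x \<mapsto> x\<^sup>K\<close>.

  If \<open>HK > 1/2\<close>, then \<open>(a + b)\<^sup>2 \<le> 2a\<^sup>2 + 2b\<^sup>2\<close> shows that the sequence increases pointwise in \<open>n\<close>.
  All its moments are bounded, so it converges in every \<open>L\<^sup>p\<close> to its supremum. The supremum
  dominates the zeroth term, the square of a nondegenerate Gaussian variable, hence is unbounded.

  If \<open>HK < 1/2\<close>, the sequence \<open>a\<^sub>n\<close> is dominated by the increments close to \<open>0\<close>, which decorrelate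
  between scales: by Wick's formula \<open>Var a\<^sub>n\<close> stays bounded away from \<open>0\<close>, whereas
  \<open>Cov(a\<^sub>n, a\<^sub>m)\<close> tends to \<open>0\<close> for fixed \<open>n\<close> as \<open>m \<rightarrow> \<infinity>\<close>. As fourth moments are bounded,
  \<open>(a\<^sub>n)\<close> is not Cauchy in probability.\<close>

section \<open>Inequalities for powers\<close>

text \<open>A concave power lies below its tangent at \<open>x\<close>. For \<open>y\<close> > 0
  this is the weighted AM-GM inequality multiplied by \<open>x powr (p - 1)\<close>.\<close>

lemma powr_le_tangent:
  fixes x y p :: real
  assumes "0 < x" "0 \<le> y" "0 \<le> p" "p \<le> 1"
  shows "y powr p \<le> x powr p + p * x powr (p - 1) * (y - x)"
proof (cases "y = 0")
  case True
  have "p * x powr (p - 1) * x = p * x powr p"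
    using assms by (simp add: powr_diff)
  moreover have "p * x powr p \<le> x powr p"
    using assms mult_right_mono[of p 1 "x powr p"] by simp
  ultimately show ?thesis
    using True by (auto simp: mult.assoc)
next
  case False
  then have y: "0 < y" using assms by simp
  have xx: "x powr (p - 1) * x powr (1 - p) = 1" "x powr (p - 1) * x = x powr p"
    using assms by (simp_all add: powr_diff)
  have "y powr p * x powr (1 - p) \<le> p * y + (1 - p) * x"
    using Youngs_inequality_0[of p "1 - p" y x] assms y by simp
  then have "x powr (p - 1) * (y powr p * x powr (1 - p)) \<le> x powr (p - 1) * (p * y + (1 - p) * x)"
    by (intro mult_left_mono) auto
  moreover have "x powr (p - 1) * (y powr p * x powr (1 - p)) = y powr p * (x powr (p - 1) * x powr (1 - p))"
    by (simp only: mult_ac)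
  moreover have "x powr (p - 1) * (p * y + (1 - p) * x)
      = x powr (p - 1) * x + p * x powr (p - 1) * (y - x)"
    by (simp add: algebra_simps)
  ultimately show ?thesis using xx by simp
qed

text \<open>This stands in for a bound on the second derivative of x^K. With q = 1 - K the left side
  is (a^q - b^q) / (a^q b^q); the tangent inequality bounds the numerator, and replacing a^q by b^q
  below only enlarges the quotient.\<close>

lemma powr_diff_reciprocal_bound:
  fixes a b K :: real
  assumes "0 < b" "b \<le> a" "0 < K" "K < 1"
  shows "b powr (K - 1) - a powr (K - 1) \<le> (1 - K) * b powr (K - 2) * (a - b)"
proof -
  have a: "0 < a" using assms by simp
  define q where "q = 1 - K"
  have q: "0 < q" "q < 1" using assms by (auto simp: q_def)
  have t: "a powr q - b powr q \<le> q * b powr (q - 1) * (a - b)"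
    using powr_le_tangent[of b a q] assms q by simp
  have "b powr (K - 1) - a powr (K - 1) = (a powr q - b powr q) / (a powr q * b powr q)"
    using a assms by (simp add: q_def powr_diff field_simps)
  also have "\<dots> \<le> (q * b powr (q - 1) * (a - b)) / (a powr q * b powr q)"
    using t by (intro divide_right_mono) auto
  also have "\<dots> \<le> (q * b powr (q - 1) * (a - b)) / (b powr q * b powr q)"
    using assms q by (intro divide_left_mono mult_right_mono powr_mono2) auto
  also have "\<dots> = q * (a - b) * (b powr (q - 1) / (b powr q * b powr q))"
    by simp
  also have "b powr (q - 1) / (b powr q * b powr q) = b powr (K - 2)"
    using assms by (simp add: q_def powr_add[symmetric] powr_diff[symmetric])
  finally show ?thesis by (simp add: q_def mult_ac)
qed

text \<open>The value at the midpoint is compared with the tangents at both ends. Adding the two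
  estimates leaves the difference of the end slopes, which \<open>powr_diff_reciprocal_bound\<close>
  controls.\<close>

lemma powr_midpoint_gap:
  fixes a b K :: real
  assumes "0 < b" "b \<le> a" "0 < K" "K < 1"
  shows "2 * ((a + b) / 2) powr K - a powr K - b powr K \<le> b powr (K - 2) * (a - b)^2"
proof -
  have a: "0 < a" using assms by simp
  have "((a + b) / 2) powr K \<le> b powr K + K * b powr (K - 1) * ((a - b) / 2)"
    using powr_le_tangent[of b "(a + b) / 2" K] assms by (simp add: field_simps)
  moreover have "((a + b) / 2) powr K \<le> a powr K - K * a powr (K - 1) * ((a - b) / 2)"
    using powr_le_tangent[of a "(a + b) / 2" K] assms by (simp add: field_simps)
  ultimately have "2 * ((a + b) / 2) powr K - a powr K - b powr K
      \<le> K * (b powr (K - 1) - a powr (K - 1)) * ((a - b) / 2)"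
    by (simp add: algebra_simps diff_divide_distrib add_divide_distrib)
  also have "\<dots> \<le> K * ((1 - K) * b powr (K - 2) * (a - b)) * ((a - b) / 2)"
    using powr_diff_reciprocal_bound[OF assms] assms
    by (intro mult_right_mono mult_left_mono) auto
  also have "\<dots> = (K * (1 - K) / 2) * (b powr (K - 2) * (a - b)^2)"
    by (simp add: power2_eq_square)
  also have "\<dots> \<le> 1 * (b powr (K - 2) * (a - b)^2)"
  proof (intro mult_right_mono)
    have "K * (1 - K) \<le> 1 * 1" using assms by (intro mult_mono) auto
    then show "K * (1 - K) / 2 \<le> 1" by simp
  qed auto
  finally show ?thesis by simp
qed

lemma powr_diff_le:
  fixes k p :: real
  assumes "2 \<le> k" "0 < p" "p < 2"
  shows "\<bar>k powr p - (k - 1) powr p\<bar> \<le> 4 * k powr (p - 1)"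
proof -
  have "\<exists>z. k - 1 < z \<and> z < k \<and> k powr p - (k - 1) powr p = (k - (k - 1)) * (p * z powr (p - 1))"
    using assms by (intro MVT2) (auto intro!: derivative_eq_intros)
  then obtain z where z: "k - 1 < z" "z < k" "k powr p - (k - 1) powr p = p * z powr (p - 1)"
    by auto
  define u where "u = z / k"
  have u: "1/2 \<le> u" "u \<le> 1" "z = u * k" using z assms by (auto simp: u_def field_simps)
  \<comment> \<open>Since \<open>u\<close> \<le> 1 and p - 1 > -1, this covers both signs of p - 1.
    The hypothesis \<open>2 \<le> k\<close> enters through \<open>u\<close> \<ge> 1/2.\<close>
  have "u powr (p - 1) \<le> u powr (- 1)"
    using u assms by (intro powr_mono') auto
  also have "\<dots> \<le> 2" using u by (simp add: powr_minus field_simps)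
  finally have "z powr (p - 1) \<le> 2 * k powr (p - 1)"
    using u assms by (simp add: powr_mult)
  then have "p * z powr (p - 1) \<le> 2 * (2 * k powr (p - 1))"
    using assms by (intro mult_mono) auto
  then show ?thesis using z assms by simp
qed

text \<open>The left side is the variance of the increment over [k - 1, k]. It equals 2^K times the
  midpoint gap of k^(2H) and (k - 1)^(2H). The exponents add up as 2H(K - 2) + 2(2H - 1) = 2HK - 2,
  the constants as 16 * 4^2 * 2 = 512. For \<open>k\<close> \<ge> 2 the lower end is positive and
  comparable to the upper one.\<close>

lemma trifractional_increment_bound:
  fixes k H K :: real
  assumes "2 \<le> k" "0 < H" "H < 1" "0 < K" "K < 1"
  shows "2 * (k powr (2*H) + (k - 1) powr (2*H)) powr K
           - 2 powr K * (k powr (2*H*K) + (k - 1) powr (2*H*K)) \<le> 512 * k powr (2*H*K - 2)"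
proof -
  define a b where "a = k powr (2*H)" and "b = (k - 1) powr (2*H)"
  have ab: "0 < b" "b \<le> a" using assms by (auto simp: a_def b_def intro: powr_mono2)
  define u where "u = (k - 1) / k"
  have u: "1/2 \<le> u" "u \<le> 1" "k - 1 = u * k" using assms by (auto simp: u_def field_simps)
  \<comment> \<open>Passing from k - 1 to k costs at most 2^4, since the exponent is at least -4 and
    \<open>u\<close> lies in [1/2, 1].\<close>
  have "u powr (2*H*(K - 2)) \<le> u powr (- 4)"
  proof (intro powr_mono')
    have "H * (2 - K) \<le> 1 * 2" using assms by (intro mult_mono) auto
    then show "- 4 \<le> 2*H*(K - 2)" by (simp add: algebra_simps)
  qed (use u in auto)
  also have "\<dots> = (1 / u)^4" using u by (simp add: powr_minus field_simps)
  also have "\<dots> \<le> 2^4" using u by (intro power_mono) (auto simp: field_simps)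
  finally have "b powr (K - 2) \<le> 16 * k powr (2*H*(K - 2))"
    using u assms by (simp add: b_def powr_powr powr_mult)
  moreover have "(a - b)^2 \<le> (4 * k powr (2*H - 1))^2"
    using powr_diff_le[of k "2*H"] assms unfolding a_def b_def
    by (intro power2_le_iff_abs_le[THEN iffD2]) auto
  ultimately have "b powr (K - 2) * (a - b)^2 \<le> 16 * k powr (2*H*(K - 2)) * (4 * k powr (2*H - 1))^2"
    by (intro mult_mono) auto
  also have "\<dots> = 256 * (k powr (2*H*(K - 2)) * (k powr (2*H - 1) * k powr (2*H - 1)))"
    by (simp add: power2_eq_square)
  also have "\<dots> = 256 * k powr (2*H*K - 2)"
    by (simp add: powr_add[symmetric] algebra_simps)
  finally have g: "2 * ((a + b) / 2) powr K - a powr K - b powr K \<le> 256 * k powr (2*H*K - 2)"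
    using powr_midpoint_gap[OF ab assms(4,5)] by linarith
  have "2 * (k powr (2*H) + (k - 1) powr (2*H)) powr K
           - 2 powr K * (k powr (2*H*K) + (k - 1) powr (2*H*K))
      = 2 powr K * (2 * ((a + b) / 2) powr K - a powr K - b powr K)"
    using ab assms by (simp add: a_def b_def powr_powr powr_divide right_diff_distrib mult_ac)
       (simp add: algebra_simps)
  also have "\<dots> \<le> 2 powr K * (256 * k powr (2*H*K - 2))"
    using g by (intro mult_left_mono) auto
  also have "\<dots> \<le> 2 powr 1 * (256 * k powr (2*H*K - 2))"
    using assms by (intro mult_right_mono powr_mono) auto
  finally show ?thesis by simp
qed

text \<open>Telescoping: the tangent at n + 1, evaluated at n, bounds \<alpha> (n + 1)^(\<alpha> -
  1) by (n + 1)^\<alpha> - n^\<alpha>.\<close>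

lemma sum_powr_le:
  fixes \<alpha> :: real
  assumes "0 < \<alpha>" "\<alpha> \<le> 1"
  shows "(\<Sum>k=1..n. real k powr (\<alpha> - 1)) \<le> real n powr \<alpha> / \<alpha>"
proof (induction n)
  case (Suc n)
  have "real n powr \<alpha> \<le> real (Suc n) powr \<alpha> - \<alpha> * real (Suc n) powr (\<alpha> - 1)"
    using powr_le_tangent[of "real (Suc n)" "real n" \<alpha>] assms by simp
  then have "(real n powr \<alpha> + \<alpha> * real (Suc n) powr (\<alpha> - 1)) / \<alpha> \<le> real (Suc n) powr \<alpha> / \<alpha>"
    using assms by (intro divide_right_mono) auto
  then have "real n powr \<alpha> / \<alpha> + real (Suc n) powr (\<alpha> - 1) \<le> real (Suc n) powr \<alpha> / \<alpha>"
    using assms by (simp add: add_divide_distrib)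
  with Suc show ?case by simp
qed simp

text \<open>Jensen's inequality for the convex function x^r, with the normalised \<open>w i\<close>
  as weights and the quotients \<open>y i / w i\<close> as points. It reduces moments of a sum to
  moments of the summands without any independence.\<close>

lemma weighted_power_sum_le:
  fixes y w :: "'i \<Rightarrow> real"
  assumes "finite I" "I \<noteq> {}" "even r" "\<And>i. i \<in> I \<Longrightarrow> 0 < w i"
  shows "(\<Sum>i\<in>I. y i) ^ r \<le> (\<Sum>i\<in>I. w i) ^ r * (\<Sum>i\<in>I. w i / (\<Sum>i\<in>I. w i) * (y i / w i) ^ r)"
proof -
  define S where "S = (\<Sum>i\<in>I. w i)"
  have S: "0 < S" using assms by (auto simp: S_def intro: sum_pos)
  have "(\<Sum>i\<in>I. (w i / S) *\<^sub>R (y i / w i)) ^ r \<le> (\<Sum>i\<in>I. w i / S * (y i / w i) ^ r)"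
  proof (rule convex_on_sum[OF assms(1,2) convex_power_even[OF assms(3)]])
    show "(\<Sum>i\<in>I. w i / S) = 1" using S by (simp add: S_def sum_divide_distrib[symmetric])
  qed (use S assms in \<open>auto intro: less_imp_le\<close>)
  moreover have "(\<Sum>i\<in>I. (w i / S) *\<^sub>R (y i / w i)) = (\<Sum>i\<in>I. y i) / S"
    unfolding sum_divide_distrib
    by (intro sum.cong refl) (use assms(4) in \<open>force simp: field_simps\<close>)
  ultimately have "((\<Sum>i\<in>I. y i) / S) ^ r \<le> (\<Sum>i\<in>I. w i / S * (y i / w i) ^ r)" by simp
  then have "S ^ r * ((\<Sum>i\<in>I. y i) / S) ^ r \<le> S ^ r * (\<Sum>i\<in>I. w i / S * (y i / w i) ^ r)"
    using S by (intro mult_left_mono) auto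
  moreover have "S ^ r * ((\<Sum>i\<in>I. y i) / S) ^ r = (\<Sum>i\<in>I. y i) ^ r"
    using S by (simp add: power_divide)
  ultimately show ?thesis by (simp add: S_def)
qed

section \<open>Centred Gaussian variables\<close>

definition centered_gaussian :: "'a measure \<Rightarrow> ('a \<Rightarrow> real) \<Rightarrow> bool" where
  "centered_gaussian M X \<longleftrightarrow> gaussian_rv M X \<and> (LINT \<omega>|M. X \<omega>) = 0"

lemma centered_gaussian_measurable [measurable_dest]:
  "centered_gaussian M X \<Longrightarrow> X \<in> borel_measurable M"
  by (simp add: centered_gaussian_def gaussian_rv_def)

text \<open>The location of a point mass and the mean of a normal law both equal the expectation, so
  both vanish.\<close>

lemma (in prob_space) centered_gaussian_cases:
  assumes "centered_gaussian M X"
  obtains "AE \<omega> in M. X \<omega> = 0"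
    | \<sigma> where "0 < \<sigma>" "distributed M lborel X (\<lambda>x. ennreal (normal_density 0 \<sigma> x))"
proof -
  have [measurable]: "X \<in> borel_measurable M" using assms by measurable
  have mean: "expectation X = 0" using assms by (simp add: centered_gaussian_def)
  from assms consider \<mu> where "AE \<omega> in M. X \<omega> = \<mu>"
    | \<mu> \<sigma> where "0 < \<sigma>" "distributed M lborel X (\<lambda>x. ennreal (normal_density \<mu> \<sigma> x))"
    by (auto simp: centered_gaussian_def gaussian_rv_def)
  then show thesis
  proof cases
    case 1
    then have "expectation X = expectation (\<lambda>_. \<mu>)" by (intro integral_cong_AE) auto
    then show thesis using 1 mean that(1) by (simp add: prob_space)
  next
    case (2 \<mu> \<sigma>)
    then have "\<mu> = expectation X"
      using distributed_integral[OF 2(2), of "\<lambda>x. x"] by (simp add: integral_normal_moment_nz_1)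
    then show thesis using 2 mean that(2) by simp
  qed
qed

lemma (in prob_space) centered_gaussian_integrable_power:
  assumes "centered_gaussian M X"
  shows "integrable M (\<lambda>\<omega>. X \<omega> ^ k)"
  using assms
proof (cases rule: centered_gaussian_cases)
  case 1
  have [measurable]: "X \<in> borel_measurable M" using assms by measurable
  have "integrable M (\<lambda>\<omega>. X \<omega> ^ k) = integrable M (\<lambda>\<omega>. 0 ^ k :: real)"
    using 1 by (intro integrable_cong_AE) auto
  then show ?thesis by simp
next
  case (2 \<sigma>)
  then show ?thesis
    using integrable_normal_moment[of \<sigma> 0 k] distributed_integrable[OF 2(2), of "\<lambda>x. x ^ k"] by simp
qed

text \<open>The factor is the double factorial (2r - 1)!!. Stating the moment through the variance
  makes the point mass at 0 obey the same formula.\<close>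

lemma (in prob_space) centered_gaussian_even_moment:
  assumes "centered_gaussian M X"
  shows "expectation (\<lambda>\<omega>. X \<omega> ^ (2 * r)) = fact (2 * r) / (2 ^ r * fact r) * expectation (\<lambda>\<omega>. (X \<omega>)^2) ^ r"
  using assms
proof (cases rule: centered_gaussian_cases)
  case 1
  have [measurable]: "X \<in> borel_measurable M" using assms by measurable
  have "expectation (\<lambda>\<omega>. X \<omega> ^ j) = expectation (\<lambda>\<omega>. 0 ^ j)" for j
    using 1 by (intro integral_cong_AE) auto
  \<comment> \<open>For \<open>r\<close> = 0 both sides are 1, because
    \<open>0 ^ 0 = 1\<close>.\<close>
  from this[of "2 * r"] this[of 2] show ?thesis by (cases r) (simp_all add: prob_space)
next
  case (2 \<sigma>)
  have m: "expectation (\<lambda>\<omega>. X \<omega> ^ (2 * j)) = fact (2 * j) / ((2 / \<sigma>^2) ^ j * fact j)" for j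
    using integral_normal_moment_even[OF 2(1), of 0 j] distributed_integral[OF 2(2), of "\<lambda>x. x ^ (2 * j)"]
    by simp
  have v: "expectation (\<lambda>\<omega>. (X \<omega>)^2) = \<sigma>^2" using m[of 1] by simp
  show ?thesis unfolding v using m[of r] 2(1) by (simp add: power_divide)
qed

text \<open>A normal density is positive everywhere, so an almost sure bound on X^2 would hold for
  Lebesgue almost every real x.\<close>

lemma (in prob_space) centered_gaussian_unbounded:
  assumes X: "centered_gaussian M X" and "0 < expectation (\<lambda>\<omega>. (X \<omega>)^2)"
  shows "\<not> (AE \<omega> in M. (X \<omega>)^2 \<le> c)"
proof
  assume bound: "AE \<omega> in M. (X \<omega>)^2 \<le> c"
  have [measurable]: "X \<in> borel_measurable M" using X by measurable
  from X show False
  proof (cases rule: centered_gaussian_cases)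
    case 1
    then have "expectation (\<lambda>\<omega>. (X \<omega>)^2) = expectation (\<lambda>\<omega>. 0)" by (intro integral_cong_AE) auto
    then show False using assms by simp
  next
    case (2 \<sigma>)
    have "AE x in lborel. 0 < ennreal (normal_density 0 \<sigma> x) \<longrightarrow> x^2 \<le> c"
      using distributed_AE2[OF 2(2), of "\<lambda>x. x^2 \<le> c"] bound by simp
    then have "AE x in lborel. x^2 \<le> c"
      by (rule AE_mp) (use 2(1) in \<open>auto simp: normal_density_pos\<close>)
    \<comment> \<open>An interval of length one on which x \<ge> 1, hence x^2 \<ge> x > c.\<close>
    then have "AE x in lborel. x \<notin> {\<bar>c\<bar> + 1..\<bar>c\<bar> + 2}"
    proof (rule AE_mp, intro AE_I2 impI notI)
      fix x :: real assume x: "x^2 \<le> c" "x \<in> {\<bar>c\<bar> + 1..\<bar>c\<bar> + 2}"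
      then have "x * 1 \<le> x * x" by (intro mult_left_mono) auto
      then have "x \<le> c" using x by (simp add: power2_eq_square)
      moreover have "\<bar>c\<bar> + 1 \<le> x" using x by simp
      ultimately show False using abs_ge_self[of c] by linarith
    qed
    then have "emeasure lborel {\<bar>c\<bar> + 1..\<bar>c\<bar> + 2} = 0"
      by (subst (asm) AE_iff_measurable[of "{\<bar>c\<bar> + 1..\<bar>c\<bar> + 2}"]) auto
    then show False by simp
  qed
qed

text \<open>Cauchy-Schwarz, from the nonnegativity in t of the quadratic E(X - tY)^2, evaluated at
  its minimiser \<open>c / b\<close>.\<close>

lemma (in prob_space) expectation_mult_power2_le:
  fixes X Y :: "'a \<Rightarrow> real"
  assumes [measurable]: "X \<in> borel_measurable M" "Y \<in> borel_measurable M"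
    and X: "integrable M (\<lambda>\<omega>. (X \<omega>)^2)" and Y: "integrable M (\<lambda>\<omega>. (Y \<omega>)^2)"
    and XY: "integrable M (\<lambda>\<omega>. X \<omega> * Y \<omega>)"
  shows "(expectation (\<lambda>\<omega>. X \<omega> * Y \<omega>))^2 \<le> expectation (\<lambda>\<omega>. (X \<omega>)^2) * expectation (\<lambda>\<omega>. (Y \<omega>)^2)"
proof -
  define a b c where "a = expectation (\<lambda>\<omega>. (X \<omega>)^2)" and "b = expectation (\<lambda>\<omega>. (Y \<omega>)^2)"
    and "c = expectation (\<lambda>\<omega>. X \<omega> * Y \<omega>)"
  have q: "0 \<le> a - 2 * t * c + t^2 * b" for t
  proof -
    have "0 \<le> expectation (\<lambda>\<omega>. (X \<omega> - t * Y \<omega>)^2)" by simp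
    also have "(\<lambda>\<omega>. (X \<omega> - t * Y \<omega>)^2) = (\<lambda>\<omega>. (X \<omega>)^2 - 2 * t * (X \<omega> * Y \<omega>) + t^2 * (Y \<omega>)^2)"
      by (auto simp: power2_eq_square algebra_simps)
    also have "expectation \<dots> = a - 2 * t * c + t^2 * b"
      using X Y XY by (simp add: a_def b_def c_def)
    finally show ?thesis .
  qed
  have "0 \<le> b" by (simp add: b_def)
  have "c^2 \<le> a * b"
  proof (cases "b = 0")
    case True
    have "c = 0"
    proof (rule ccontr)
      assume "c \<noteq> 0"
      \<comment> \<open>With \<open>b\<close> = 0 the quadratic is the affine function a - 2tc, and
        this t gives it the value -1.\<close>
      then show False using q[of "(a + 1) / (2 * c)"] True by simp
    qed
    then show ?thesis using True by simp
  next
    case False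
    then have "0 \<le> (a - 2 * (c / b) * c + (c / b)^2 * b) * b"
      using q[of "c / b"] \<open>0 \<le> b\<close> by (intro mult_nonneg_nonneg)
    also have "\<dots> = a * b - c^2"
      using False by (simp add: power2_eq_square field_simps)
    finally show ?thesis by simp
  qed
  then show ?thesis by (simp add: a_def b_def c_def)
qed

text \<open>Polarisation: fourth moments of \<open>X \<plusminus> Y\<close> determine the mixed moment.\<close>

lemma (in prob_space) centered_gaussian_wick:
  assumes X: "centered_gaussian M X" and Y: "centered_gaussian M Y"
    and P: "centered_gaussian M (\<lambda>\<omega>. X \<omega> + Y \<omega>)" and N: "centered_gaussian M (\<lambda>\<omega>. X \<omega> - Y \<omega>)"
  shows "integrable M (\<lambda>\<omega>. X \<omega> * Y \<omega>)"
    and "integrable M (\<lambda>\<omega>. (X \<omega>)^2 * (Y \<omega>)^2)"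
    and "expectation (\<lambda>\<omega>. (X \<omega>)^2 * (Y \<omega>)^2)
       = expectation (\<lambda>\<omega>. (X \<omega>)^2) * expectation (\<lambda>\<omega>. (Y \<omega>)^2) + 2 * (expectation (\<lambda>\<omega>. X \<omega> * Y \<omega>))^2"
proof -
  note int = X[THEN centered_gaussian_integrable_power] Y[THEN centered_gaussian_integrable_power]
    P[THEN centered_gaussian_integrable_power] N[THEN centered_gaussian_integrable_power]
  have m4: "expectation (\<lambda>\<omega>. V \<omega> ^ 4) = 3 * expectation (\<lambda>\<omega>. (V \<omega>)^2)^2" if "centered_gaussian M V" for V
    using centered_gaussian_even_moment[OF that, of 2] by (simp add: fact_numeral)
  have xy: "(\<lambda>\<omega>. X \<omega> * Y \<omega>) = (\<lambda>\<omega>. ((X \<omega> + Y \<omega>)^2 - (X \<omega> - Y \<omega>)^2) / 4)"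
    by (auto simp: power2_eq_square field_simps)
  show XY: "integrable M (\<lambda>\<omega>. X \<omega> * Y \<omega>)" unfolding xy using int by simp
  have x2y2: "(\<lambda>\<omega>. (X \<omega>)^2 * (Y \<omega>)^2)
      = (\<lambda>\<omega>. ((X \<omega> + Y \<omega>)^4 + (X \<omega> - Y \<omega>)^4 - 2 * X \<omega> ^ 4 - 2 * Y \<omega> ^ 4) / 12)"
    by (auto simp: power4_eq_xxxx power2_eq_square field_simps)
  show "integrable M (\<lambda>\<omega>. (X \<omega>)^2 * (Y \<omega>)^2)" unfolding x2y2 using int by simp
  define a b c where "a = expectation (\<lambda>\<omega>. (X \<omega>)^2)" and "b = expectation (\<lambda>\<omega>. (Y \<omega>)^2)"
    and "c = expectation (\<lambda>\<omega>. X \<omega> * Y \<omega>)"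
  have "expectation (\<lambda>\<omega>. (X \<omega> + Y \<omega>)^2) = expectation (\<lambda>\<omega>. (X \<omega>)^2 + (Y \<omega>)^2 + 2 * (X \<omega> * Y \<omega>))"
    by (auto simp: power2_eq_square algebra_simps)
  then have p: "expectation (\<lambda>\<omega>. (X \<omega> + Y \<omega>)^2) = a + b + 2 * c"
    using int XY by (simp add: a_def b_def c_def)
  have "expectation (\<lambda>\<omega>. (X \<omega> - Y \<omega>)^2) = expectation (\<lambda>\<omega>. (X \<omega>)^2 + (Y \<omega>)^2 - 2 * (X \<omega> * Y \<omega>))"
    by (auto simp: power2_eq_square algebra_simps)
  then have n: "expectation (\<lambda>\<omega>. (X \<omega> - Y \<omega>)^2) = a + b - 2 * c"
    using int XY by (simp add: a_def b_def c_def)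
  have "expectation (\<lambda>\<omega>. (X \<omega>)^2 * (Y \<omega>)^2)
      = (3 * (a + b + 2 * c)^2 + 3 * (a + b - 2 * c)^2 - 2 * (3 * a^2) - 2 * (3 * b^2)) / 12"
    unfolding x2y2 using int m4[OF X] m4[OF Y] m4[OF P] m4[OF N] p n by (simp add: a_def b_def)
  also have "\<dots> = a * b + 2 * c^2" by (simp add: power2_eq_square field_simps)
  finally show "expectation (\<lambda>\<omega>. (X \<omega>)^2 * (Y \<omega>)^2)
       = expectation (\<lambda>\<omega>. (X \<omega>)^2) * expectation (\<lambda>\<omega>. (Y \<omega>)^2) + 2 * (expectation (\<lambda>\<omega>. X \<omega> * Y \<omega>))^2"
    by (simp add: a_def b_def c_def)
qed

text \<open>Weighted Jensen, after which each normalised summand has r-th moment at most (2r - 1)!!.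
  The weights are positive upper bounds instead of the variances themselves, so degenerate
  \<open>X i\<close> cause no division by zero.\<close>

lemma (in prob_space) gaussian_square_sum_moment:
  fixes X :: "'i \<Rightarrow> 'a \<Rightarrow> real"
  assumes "finite I" "I \<noteq> {}" "even r"
    and X: "\<And>i. i \<in> I \<Longrightarrow> centered_gaussian M (X i)"
    and w: "\<And>i. i \<in> I \<Longrightarrow> 0 < w i" "\<And>i. i \<in> I \<Longrightarrow> expectation (\<lambda>\<omega>. (X i \<omega>)^2) \<le> w i"
  shows "integrable M (\<lambda>\<omega>. (\<Sum>i\<in>I. (X i \<omega>)^2) ^ r)"
    and "expectation (\<lambda>\<omega>. (\<Sum>i\<in>I. (X i \<omega>)^2) ^ r)
      \<le> fact (2 * r) / (2 ^ r * fact r) * (\<Sum>i\<in>I. w i) ^ r"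
proof -
  define S where "S = (\<Sum>i\<in>I. w i)"
  have S: "0 < S" using assms by (auto simp: S_def intro: sum_pos)
  let ?B = "\<lambda>\<omega>. S ^ r * (\<Sum>i\<in>I. w i / S * ((X i \<omega>)^2 / w i) ^ r)"
  have le: "(\<Sum>i\<in>I. (X i \<omega>)^2) ^ r \<le> ?B \<omega>" for \<omega>
    unfolding S_def by (rule weighted_power_sum_le) (use assms in auto)
  have int: "integrable M (\<lambda>\<omega>. ((X i \<omega>)^2 / w i) ^ r)" if "i \<in> I" for i
    using centered_gaussian_integrable_power[OF X[OF that], of "2 * r"]
    by (simp add: power_divide power_mult)
  have B: "integrable M ?B" using int by (intro integrable_mult_right integrable_sum) auto
  have [measurable]: "X i \<in> borel_measurable M" if "i \<in> I" for i using X[OF that] by measurable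
  show I: "integrable M (\<lambda>\<omega>. (\<Sum>i\<in>I. (X i \<omega>)^2) ^ r)"
    using B
  proof (rule Bochner_Integration.integrable_bound)
    show "AE \<omega> in M. norm ((\<Sum>i\<in>I. (X i \<omega>)^2) ^ r) \<le> norm (?B \<omega>)"
    proof (intro AE_I2)
      fix \<omega>
      have "norm ((\<Sum>i\<in>I. (X i \<omega>)^2) ^ r) = (\<Sum>i\<in>I. (X i \<omega>)^2) ^ r" by (simp add: sum_nonneg)
      also have "\<dots> \<le> norm (?B \<omega>)" using le[of \<omega>] abs_ge_self[of "?B \<omega>"] by simp
      finally show "norm ((\<Sum>i\<in>I. (X i \<omega>)^2) ^ r) \<le> norm (?B \<omega>)" .
    qed
  qed measurable
  define C :: real where "C = fact (2 * r) / (2 ^ r * fact r)"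
  have mom: "expectation (\<lambda>\<omega>. ((X i \<omega>)^2 / w i) ^ r) \<le> C" if "i \<in> I" for i
  proof -
    have "expectation (\<lambda>\<omega>. ((X i \<omega>)^2 / w i) ^ r) = expectation (\<lambda>\<omega>. X i \<omega> ^ (2 * r)) / w i ^ r"
      by (simp add: power_divide power_mult)
    also have "\<dots> = C * (expectation (\<lambda>\<omega>. (X i \<omega>)^2) / w i) ^ r"
      by (simp add: centered_gaussian_even_moment[OF X[OF that]] C_def power_divide)
    also have "\<dots> \<le> C * 1"
      using w[OF that] by (intro mult_left_mono power_le_one) (auto simp: C_def)
    finally show ?thesis by simp
  qed
  have "expectation (\<lambda>\<omega>. (\<Sum>i\<in>I. (X i \<omega>)^2) ^ r) \<le> expectation ?B"
    using I B le by (intro integral_mono) auto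
  also have "\<dots> = S ^ r * (\<Sum>i\<in>I. w i / S * expectation (\<lambda>\<omega>. ((X i \<omega>)^2 / w i) ^ r))"
    using int by simp
  also have "\<dots> \<le> S ^ r * (\<Sum>i\<in>I. w i / S * C)"
    using mom w S by (intro mult_left_mono sum_mono) (auto intro: less_imp_le)
  also have "(\<Sum>i\<in>I. w i / S * C) = C"
    using S by (simp add: sum_distrib_right[symmetric] sum_divide_distrib[symmetric] S_def[symmetric])
  finally show "expectation (\<lambda>\<omega>. (\<Sum>i\<in>I. (X i \<omega>)^2) ^ r) \<le> C * S ^ r" by (simp add: mult.commute)
qed

section \<open>Criteria for convergence\<close>

lemma powr_le_one_add_power:
  fixes x p :: real
  assumes "0 \<le> x" "0 < p" "p \<le> real r"
  shows "x powr p \<le> 1 + x ^ r"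
proof (cases "x \<le> 1")
  case True
  have "x powr p \<le> 1 powr p" using True assms by (intro powr_mono2) auto
  then show ?thesis using assms by (simp add: add_increasing2)
next
  case False
  then have "x powr p \<le> x powr real r" using assms by (intro powr_mono) auto
  then show ?thesis using False by (simp add: powr_realpow)
qed

text \<open>Monotone convergence passes the moment bounds to the supremum, and powers of the
  supremum then allow dominated convergence. The same \<open>L\<close> serves every
  exponent.\<close>

lemma (in prob_space) incseq_bounded_moments_converges_in_Lp:
  fixes Q :: "nat \<Rightarrow> 'a \<Rightarrow> real"
  assumes [measurable]: "\<And>n. Q n \<in> borel_measurable M"
    and nonneg: "\<And>n \<omega>. 0 \<le> Q n \<omega>" and mono: "\<And>\<omega>. incseq (\<lambda>n. Q n \<omega>)"
    and int: "\<And>n r. even r \<Longrightarrow> integrable M (\<lambda>\<omega>. Q n \<omega> ^ r)"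
    and bound: "\<And>r. even r \<Longrightarrow> \<exists>B. \<forall>n. expectation (\<lambda>\<omega>. Q n \<omega> ^ r) \<le> B"
  obtains L where "L \<in> borel_measurable M" "AE \<omega> in M. \<forall>n. Q n \<omega> \<le> L \<omega>"
    "\<And>p. 1 < p \<Longrightarrow> converges_in_Lp M p Q L"
proof -
  define S where "S \<omega> = (SUP n. ennreal (Q n \<omega>))" for \<omega>
  \<comment> \<open>\<open>enn2real\<close> sends infinity to 0, which changes the supremum only
    where \<open>S\<close> is infinite, a null set by the next step.\<close>
  define L where "L \<omega> = enn2real (S \<omega>)" for \<omega>
  have [measurable]: "S \<in> borel_measurable M" "L \<in> borel_measurable M"
    unfolding S_def[abs_def] L_def[abs_def] by measurable
  have "(\<integral>\<^sup>+ \<omega>. S \<omega> \<partial>M) < \<infinity>"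
  proof -
    obtain B where B: "\<And>n. expectation (\<lambda>\<omega>. (Q n \<omega>)^2) \<le> B" using bound[of 2] by auto
    have "(\<integral>\<^sup>+ \<omega>. ennreal (Q n \<omega>) \<partial>M) \<le> ennreal (1 + B)" for n
    proof -
      have "(\<integral>\<^sup>+ \<omega>. ennreal (Q n \<omega>) \<partial>M) \<le> (\<integral>\<^sup>+ \<omega>. ennreal (1 + (Q n \<omega>)^2) \<partial>M)"
        \<comment> \<open>Only even moments are controlled, so the first one is bounded through q
          \<le> 1 + q^2.\<close>
        using powr_le_one_add_power[of "Q n _" 1 2] nonneg
        by (intro nn_integral_mono ennreal_leI) auto
      also have "\<dots> = ennreal (expectation (\<lambda>\<omega>. 1 + (Q n \<omega>)^2))"
        using int[of 2 n] by (intro nn_integral_eq_integral) (auto simp: add_nonneg_nonneg)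
      also have "\<dots> \<le> ennreal (1 + B)"
        using int[of 2 n] B[of n] by (intro ennreal_leI) (simp add: prob_space)
      finally show ?thesis .
    qed
    then have "(\<integral>\<^sup>+ \<omega>. S \<omega> \<partial>M) \<le> ennreal (1 + B)"
      unfolding S_def using mono
      by (subst nn_integral_monotone_convergence_SUP)
         (auto simp: incseq_def le_fun_def intro!: SUP_least ennreal_leI)
    then show ?thesis using ennreal_less_top[of "1 + B"] by (metis infinity_ennreal_def le_less_trans)
  qed
  then have fin: "AE \<omega> in M. S \<omega> \<noteq> \<infinity>" by (intro nn_integral_PInf_AE) auto
  have le: "AE \<omega> in M. \<forall>n. Q n \<omega> \<le> L \<omega>"
    using fin
  proof eventually_elim
    case (elim \<omega>)
    then have "ennreal (L \<omega>) = S \<omega>" by (simp add: L_def less_top)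
    moreover have "ennreal (Q n \<omega>) \<le> S \<omega>" for n unfolding S_def by (intro SUP_upper) auto
    ultimately have "ennreal (Q n \<omega>) \<le> ennreal (L \<omega>)" for n by simp
    moreover have "0 \<le> L \<omega>" by (simp add: L_def)
    ultimately show ?case by simp
  qed
  have lim: "AE \<omega> in M. (\<lambda>n. Q n \<omega>) \<longlonglongrightarrow> L \<omega>"
    using fin
  proof eventually_elim
    case (elim \<omega>)
    have "(\<lambda>n. ennreal (Q n \<omega>)) \<longlonglongrightarrow> S \<omega>"
      unfolding S_def using mono by (intro LIMSEQ_SUP) (auto simp: incseq_def intro: ennreal_leI)
    also have "S \<omega> = ennreal (L \<omega>)" using elim by (simp add: L_def less_top)
    finally show ?case using nonneg by (subst (asm) tendsto_ennreal_iff) (auto simp: L_def)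
  qed
  have Lint: "integrable M (\<lambda>\<omega>. L \<omega> ^ r)" if r: "even r" for r
  proof -
    obtain B where B: "\<And>n. expectation (\<lambda>\<omega>. Q n \<omega> ^ r) \<le> B" using bound[OF r] by auto
    have "incseq (\<lambda>n. expectation (\<lambda>\<omega>. Q n \<omega> ^ r))"
      using mono nonneg int[OF r]
      by (auto simp: incseq_def intro!: integral_mono power_mono)
    then obtain x where "(\<lambda>n. expectation (\<lambda>\<omega>. Q n \<omega> ^ r)) \<longlonglongrightarrow> x"
      using incseq_convergent B by blast
    then show ?thesis
    proof (rule integrable_monotone_convergence[rotated 3])
      show "AE \<omega> in M. (\<lambda>i. Q i \<omega> ^ r) \<longlonglongrightarrow> L \<omega> ^ r"
        using lim by eventually_elim (rule tendsto_power)
      show "AE \<omega> in M. mono (\<lambda>n. Q n \<omega> ^ r)"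
        using mono nonneg by (intro AE_I2) (auto simp: incseq_def mono_def intro!: power_mono)
    qed (use int[OF r] in auto)
  qed
  have Lp: "converges_in_Lp M p Q L" if "1 < p" for p
  proof -
    obtain r :: nat where r: "even r" "p \<le> real r"
    proof
      show "p \<le> real (2 * nat \<lceil>p\<rceil>)" using that by linarith
    qed simp
    \<comment> \<open>Almost surely 0 \<le> Q n \<le> L, hence |Q n - L| \<le> L, and this function
      dominates the p-th powers of \<open>Q n\<close>, \<open>L\<close> and their
      difference.\<close>
    have dom: "integrable M (\<lambda>\<omega>. 1 + L \<omega> ^ r)" using Lint[OF r(1)] by simp
    have L0: "0 \<le> L \<omega>" for \<omega> by (simp add: L_def)
    have bd: "\<bar>x\<bar> powr p \<le> 1 + L \<omega> ^ r" if "\<bar>x\<bar> \<le> L \<omega>" for x \<omega>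
    proof -
      have "\<bar>x\<bar> powr p \<le> L \<omega> powr p" using that \<open>1 < p\<close> by (intro powr_mono2) auto
      also have "\<dots> \<le> 1 + L \<omega> ^ r" using L0 r \<open>1 < p\<close> by (intro powr_le_one_add_power) auto
      finally show ?thesis .
    qed
    have dominated: "integrable M (\<lambda>\<omega>. \<bar>f \<omega>\<bar> powr p)"
      if [measurable]: "f \<in> borel_measurable M" and f: "AE \<omega> in M. \<bar>f \<omega>\<bar> \<le> L \<omega>" for f
      using dom
    proof (rule Bochner_Integration.integrable_bound)
      show "AE \<omega> in M. norm (\<bar>f \<omega>\<bar> powr p) \<le> norm (1 + L \<omega> ^ r)"
        using f by eventually_elim (use bd in \<open>auto simp: L0 intro: order_trans\<close>)
    qed measurable
    have "integrable M (\<lambda>\<omega>. \<bar>Q n \<omega>\<bar> powr p)" for n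
      using le nonneg by (intro dominated) (auto elim: eventually_mono)
    moreover have "integrable M (\<lambda>\<omega>. \<bar>L \<omega>\<bar> powr p)"
      by (intro dominated) (auto simp: L0)
    moreover have "(\<lambda>n. expectation (\<lambda>\<omega>. \<bar>Q n \<omega> - L \<omega>\<bar> powr p)) \<longlonglongrightarrow> expectation (\<lambda>\<omega>. 0)"
    proof (rule integral_dominated_convergence[OF _ _ dom])
      show "AE \<omega> in M. (\<lambda>n. \<bar>Q n \<omega> - L \<omega>\<bar> powr p) \<longlonglongrightarrow> 0"
        using lim
      proof eventually_elim
        case (elim \<omega>)
        have "(\<lambda>n. \<bar>Q n \<omega> - L \<omega>\<bar>) \<longlonglongrightarrow> 0"
          using elim by (intro tendsto_rabs_zero) (simp add: LIM_zero)
        then show ?case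
          using \<open>1 < p\<close> by (intro tendsto_zero_powrI[where b = p]) auto
      qed
      show "AE \<omega> in M. norm (\<bar>Q n \<omega> - L \<omega>\<bar> powr p) \<le> 1 + L \<omega> ^ r" for n
        using le
      proof eventually_elim
        case (elim \<omega>)
        then have "Q n \<omega> \<le> L \<omega>" by blast
        then have "\<bar>Q n \<omega> - L \<omega>\<bar> \<le> L \<omega>" using nonneg[of n \<omega>] by linarith
        then show ?case using bd by simp
      qed
    qed measurable
    ultimately show ?thesis
      by (auto simp: converges_in_Lp_def in_Lp_def)
  qed
  show thesis
    by (rule that[of L]) (use le Lp in auto)
qed

text \<open>Where |d| \<le> v the first term suffices; elsewhere expand (\<kappa> d^2 - 1)^2 \<ge>
  0. The free parameter \<kappa> trades the fourth moment against the probability of a large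
  deviation.\<close>

lemma power2_le_two_point_split:
  fixes d v \<kappa> :: real
  assumes "0 < v" "0 < \<kappa>"
  shows "d^2 \<le> v^2 + \<kappa> / 2 * d^4 + (if v < \<bar>d\<bar> then 1 else 0) / (2 * \<kappa>)"
proof (cases "v < \<bar>d\<bar>")
  case True
  have "0 \<le> (\<kappa> * d^2 - 1)^2 / (2 * \<kappa>)" using assms by simp
  also have "\<dots> = \<kappa> / 2 * d^4 + 1 / (2 * \<kappa>) - d^2"
    using assms by (simp add: power2_eq_square power4_eq_xxxx field_simps)
  finally have "d^2 \<le> \<kappa> / 2 * d^4 + 1 / (2 * \<kappa>)" by simp
  then have "d^2 \<le> v^2 + (\<kappa> / 2 * d^4 + 1 / (2 * \<kappa>))"
    using zero_le_power2[of v] by linarith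
  then show ?thesis using True by (simp add: add.assoc)
next
  case False
  then have "d^2 \<le> v^2" using assms by (intro power2_le_iff_abs_le[THEN iffD2]) auto
  then show ?thesis using False assms by (simp add: add_increasing2)
qed

text \<open>Bounded fourth moments upgrade the lower bound on the \<open>L\<^sup>2\<close>-distances to a lower bound on
  \<open>P(\<bar>X\<^sub>n - X\<^sub>m\<bar> > v)\<close>, as in the Paley--Zygmund inequality.\<close>

lemma (in prob_space) not_converges_in_probability:
  fixes X :: "nat \<Rightarrow> 'a \<Rightarrow> real"
  assumes [measurable]: "\<And>n. X n \<in> borel_measurable M"
    and nonneg: "\<And>n \<omega>. 0 \<le> X n \<omega>"
    and int: "\<And>n. integrable M (\<lambda>\<omega>. X n \<omega> ^ 4)" and bound: "\<And>n. expectation (\<lambda>\<omega>. X n \<omega> ^ 4) \<le> B"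
    and "0 < v" and sep: "\<And>n. \<forall>\<^sub>F m in sequentially. 2 * v^2 \<le> expectation (\<lambda>\<omega>. (X n \<omega> - X m \<omega>)^2)"
  shows "\<not> converges_in_probability M X L"
proof
  assume conv: "converges_in_probability M X L"
  then have [measurable]: "L \<in> borel_measurable M" by (simp add: converges_in_probability_def)
  define C where "C = \<bar>B\<bar> + 1"
  have C: "0 < C" "expectation (\<lambda>\<omega>. X n \<omega> ^ 4) \<le> C" for n
    using bound[of n] abs_ge_self[of B] abs_ge_zero[of B] unfolding C_def by linarith+
  have far: "v^4 / (2 * C) \<le> prob {\<omega> \<in> space M. v < \<bar>X n \<omega> - X m \<omega>\<bar>}"
    if "2 * v^2 \<le> expectation (\<lambda>\<omega>. (X n \<omega> - X m \<omega>)^2)" for n m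
  proof -
    let ?D = "\<lambda>\<omega>. X n \<omega> - X m \<omega>" and ?A = "{\<omega> \<in> space M. v < \<bar>X n \<omega> - X m \<omega>\<bar>}"
    \<comment> \<open>Chosen so that the fourth-moment term, at most \<kappa> C, is v^2 / 2. Of the
      lower bound 2 v^2 there remains v^2 / 2 for the probability term.\<close>
    define \<kappa> where "\<kappa> = v^2 / (2 * C)"
    have l: "0 < \<kappa>" using C \<open>0 < v\<close> by (simp add: \<kappa>_def)
    \<comment> \<open>For nonnegative numbers the distance is at most the maximum, so no binomial
      constants appear.\<close>
    have d4: "?D \<omega> ^ 4 \<le> X n \<omega> ^ 4 + X m \<omega> ^ 4" for \<omega>
    proof -
      have "?D \<omega> ^ 4 = \<bar>?D \<omega>\<bar> ^ 4" by simp
      also have "\<dots> \<le> max (X n \<omega>) (X m \<omega>) ^ 4"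
        using nonneg[of n \<omega>] nonneg[of m \<omega>] by (intro power_mono) auto
      also have "\<dots> \<le> X n \<omega> ^ 4 + X m \<omega> ^ 4" by (auto simp: max_def)
      finally show ?thesis .
    qed
    have i4: "integrable M (\<lambda>\<omega>. ?D \<omega> ^ 4)"
      by (rule Bochner_Integration.integrable_bound[OF Bochner_Integration.integrable_add[OF int int]])
         (use d4 in auto)
    have iA: "integrable M (indicator ?A :: 'a \<Rightarrow> real)" by (intro integrable_real_indicator) (auto simp: less_top[symmetric])
    let ?R = "\<lambda>\<omega>. v^2 + \<kappa> / 2 * ?D \<omega> ^ 4 + indicator ?A \<omega> / (2 * \<kappa>)"
    have iR: "integrable M ?R" using i4 iA by simp
    have d2: "?D \<omega> ^ 2 \<le> ?R \<omega>" if "\<omega> \<in> space M" for \<omega>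
      using power2_le_two_point_split[OF \<open>0 < v\<close> l, of "?D \<omega>"] that by (auto simp: indicator_def)
    have "2 * v^2 \<le> expectation (\<lambda>\<omega>. ?D \<omega> ^ 2)" by fact
    also have "\<dots> \<le> expectation ?R"
    proof (intro integral_mono iR d2)
      show "integrable M (\<lambda>\<omega>. ?D \<omega> ^ 2)"
        by (rule Bochner_Integration.integrable_bound[OF iR])
           (use d2 in \<open>auto intro: order_trans[OF _ abs_ge_self]\<close>)
    qed
    also have "\<dots> = v^2 + \<kappa> / 2 * expectation (\<lambda>\<omega>. ?D \<omega> ^ 4) + prob ?A / (2 * \<kappa>)"
      using i4 iA by (simp add: prob_space)
    also have "\<dots> \<le> v^2 + \<kappa> / 2 * (2 * C) + prob ?A / (2 * \<kappa>)"
    proof -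
      have "expectation (\<lambda>\<omega>. ?D \<omega> ^ 4) \<le> expectation (\<lambda>\<omega>. X n \<omega> ^ 4 + X m \<omega> ^ 4)"
        using i4 int d4 by (intro integral_mono) auto
      also have "\<dots> \<le> 2 * C" using int C(2)[of n] C(2)[of m] by simp
      finally show ?thesis using l by (intro add_mono mult_left_mono) auto
    qed
    also have "\<kappa> / 2 * (2 * C) = v^2 / 2" using C by (simp add: \<kappa>_def)
    also have "prob ?A / (2 * \<kappa>) = prob ?A * C / v^2" using C \<open>0 < v\<close> by (simp add: \<kappa>_def field_simps)
    finally have "v^2 / 2 \<le> prob ?A * C / v^2" by linarith
    then show ?thesis
      using C \<open>0 < v\<close> by (simp add: field_simps power2_eq_square power4_eq_xxxx)
  qed
  define \<delta> where "\<delta> = v^4 / (2 * C)"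
  have "0 < \<delta>" using C \<open>0 < v\<close> by (simp add: \<delta>_def)
  let ?E = "\<lambda>n. {\<omega> \<in> space M. v / 2 < \<bar>X n \<omega> - L \<omega>\<bar>}"
  have "(\<lambda>n. prob (?E n)) \<longlonglongrightarrow> 0"
    using conv half_gt_zero[OF \<open>0 < v\<close>] unfolding converges_in_probability_def by blast
  then have near: "\<forall>\<^sub>F n in sequentially. prob (?E n) < \<delta> / 2"
    using \<open>0 < \<delta>\<close> by (intro order_tendstoD) auto
  \<comment> \<open>The order of choice matters: \<open>n\<close> is fixed first, since the
    separation holds only for \<open>m\<close> large depending on \<open>n\<close>.\<close>
  then obtain n where n: "prob (?E n) < \<delta> / 2"
    using eventually_happens by force
  obtain m where m: "prob (?E m) < \<delta> / 2" "2 * v^2 \<le> expectation (\<lambda>\<omega>. (X n \<omega> - X m \<omega>)^2)"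
    using eventually_happens[OF eventually_conj[OF near sep[of n]]] by force
  have "\<delta> \<le> prob {\<omega> \<in> space M. v < \<bar>X n \<omega> - X m \<omega>\<bar>}" using far[OF m(2)] by (simp add: \<delta>_def)
  also have "\<dots> \<le> prob (?E n \<union> ?E m)"
  proof (intro finite_measure_mono subsetI)
    fix \<omega> assume \<omega>: "\<omega> \<in> {\<omega> \<in> space M. v < \<bar>X n \<omega> - X m \<omega>\<bar>}"
    have "\<bar>X n \<omega> - X m \<omega>\<bar> \<le> \<bar>X n \<omega> - L \<omega>\<bar> + \<bar>X m \<omega> - L \<omega>\<bar>" by linarith
    with \<omega> have "v / 2 < \<bar>X n \<omega> - L \<omega>\<bar> \<or> v / 2 < \<bar>X m \<omega> - L \<omega>\<bar>"
      unfolding mem_Collect_eq by linarith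
    then show "\<omega> \<in> ?E n \<union> ?E m" using \<omega> by blast
  qed auto
  also have "\<dots> \<le> prob (?E n) + prob (?E m)" by (intro measure_Un_le) auto
  finally show False using n m by simp
qed

section \<open>The trifractional covariance\<close>

text \<open>Self-similarity: every term is homogeneous of degree 2HK. This reduces dyadic increments
  to increments of unit mesh.\<close>

lemma trifractional_cov_scale:
  assumes "0 \<le> h" "0 \<le> s" "0 \<le> t"
  shows "trifractional_cov H K (h * s) (h * t) = h powr (2 * H * K) * trifractional_cov H K s t"
proof -
  have "(h * t) powr (2 * H) + (h * s) powr (2 * H) = h powr (2 * H) * (t powr (2 * H) + s powr (2 * H))"
    using assms by (simp add: powr_mult algebra_simps)
  then have "((h * t) powr (2 * H) + (h * s) powr (2 * H)) powr K
      = h powr (2 * H * K) * (t powr (2 * H) + s powr (2 * H)) powr K"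
    by (simp add: powr_mult powr_powr)
  then show ?thesis
    using assms unfolding trifractional_cov_def by (simp add: powr_mult algebra_simps)
qed

lemma trifractional_cov_same:
  "0 \<le> t \<Longrightarrow> trifractional_cov H K t t = (2 - 2 powr K) * t powr (2 * H * K)"
  by (simp add: trifractional_cov_def powr_mult powr_powr algebra_simps flip: mult_2)

lemma trifractional_cov_0: "trifractional_cov H K t 0 = 0"
  by (simp add: trifractional_cov_def powr_powr)

lemma trifractional_cov_commute: "trifractional_cov H K s t = trifractional_cov H K t s"
  by (simp add: trifractional_cov_def add.commute)

text \<open>With a = t^(2H) and b = s^(2H), the quantity (a + b)^K lies between a^K and the tangent
  to x^K at a. The bound is meant for fixed \<open>t\<close> and small \<open>s\<close>.\<close>

lemma trifractional_cov_abs_le: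
  assumes "0 < t" "0 \<le> s" "0 \<le> K" "K \<le> 1"
  shows "\<bar>trifractional_cov H K t s\<bar>
    \<le> s powr (2 * H * K) + K * (t powr (2 * H)) powr (K - 1) * s powr (2 * H)"
proof -
  define a b where "a = t powr (2 * H)" and "b = s powr (2 * H)"
  have ab: "0 < a" "0 \<le> b" using assms by (auto simp: a_def b_def)
  have "(a + b) powr K \<le> a powr K + K * a powr (K - 1) * b"
    using powr_le_tangent[of a "a + b" K] ab assms by simp
  moreover have "a powr K \<le> (a + b) powr K" using ab assms by (intro powr_mono2) auto
  moreover have "0 \<le> b powr K" "0 \<le> K * a powr (K - 1) * b" using ab assms by simp_all
  ultimately have "\<bar>b powr K + a powr K - (a + b) powr K\<bar> \<le> b powr K + K * a powr (K - 1) * b"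
    by linarith
  then show ?thesis
    by (simp add: trifractional_cov_def a_def b_def powr_powr add.commute)
qed

lemma two_powr_mult_tendsto_0:
  fixes q :: real
  assumes "q < 0"
  shows "(\<lambda>m. 2 powr (q * real m)) \<longlonglongrightarrow> 0"
proof -
  have "(\<lambda>m. (2 powr q) ^ m) \<longlonglongrightarrow> 0"
    using assms by (intro LIMSEQ_power_zero) (simp add: powr_less_one)
  then show ?thesis by (simp add: powr_realpow[symmetric] powr_powr)
qed

text \<open>For fixed \<open>t\<close> > 0 the covariance is of order 2^(-2HKm) + 2^(-2Hm), and both
  terms beat the normalisation 2^(HKm).\<close>

lemma scaled_trifractional_cov_tendsto_0:
  assumes "0 < H" "0 < K" "K < 1" "0 \<le> t" "0 \<le> x"
  shows "(\<lambda>m. 2 powr (H * K * real m) * trifractional_cov H K t (x / 2^m)) \<longlonglongrightarrow> 0"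
\<comment> \<open>The tangent estimate needs a positive base point; at time 0 the covariance
  vanishes outright.\<close>
proof (cases "t = 0")
  case True
  then show ?thesis
    by (simp add: trifractional_cov_commute[of _ _ 0] trifractional_cov_0)
next
  case False
  define c where "c = K * (t powr (2 * H)) powr (K - 1)"
  have scale: "2 powr (H * K * real m) * (x / 2^m) powr p = x powr p * 2 powr ((H * K - p) * real m)" for p m
  proof -
    have "(x / 2^m) powr p = x powr p / 2 powr (p * real m)"
      using assms by (simp add: powr_divide powr_realpow[symmetric] powr_powr mult.commute)
    moreover have "2 powr ((H * K - p) * real m) = 2 powr (H * K * real m) / 2 powr (p * real m)"
      by (simp only: left_diff_distrib powr_diff)
    ultimately show ?thesis by simp
  qed
  have "H * K < H * 2" using assms by simp
  then have "(\<lambda>m. x powr (2*H*K) * 2 powr ((H*K - 2*H*K) * real m)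
      + c * (x powr (2*H) * 2 powr ((H*K - 2*H) * real m))) \<longlonglongrightarrow> x powr (2*H*K) * 0 + c * (x powr (2*H) * 0)"
    using assms by (intro tendsto_intros two_powr_mult_tendsto_0) auto
  then have "(\<lambda>m. 2 powr (H * K * real m) * ((x / 2^m) powr (2*H*K) + c * (x / 2^m) powr (2*H))) \<longlonglongrightarrow> 0"
    by (simp only: scale[symmetric] distrib_left mult.left_commute[of c] mult_zero_right add_0_right)
  then show ?thesis
  proof (rule Lim_null_comparison[rotated], intro always_eventually allI)
    fix m
    show "norm (2 powr (H * K * real m) * trifractional_cov H K t (x / 2^m))
       \<le> 2 powr (H * K * real m) * ((x / 2^m) powr (2*H*K) + c * (x / 2^m) powr (2*H))"
      using trifractional_cov_abs_le[of t "x / 2^m" K H] assms False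
      by (auto simp: abs_mult c_def intro!: mult_left_mono)
  qed
qed

text \<open>Groups the two halves, numbered 2k - 1 and 2k, of the k-th interval of the coarser
  partition.\<close>

lemma sum_pairs:
  fixes f :: "nat \<Rightarrow> 'b::comm_monoid_add"
  shows "(\<Sum>k=1..2 * N. f k) = (\<Sum>k=1..N. f (2 * k - 1) + f (2 * k))"
proof (induction N)
  case (Suc N)
  have "{1..2 * Suc N} = insert (2 * Suc N) (insert (2 * Suc N - 1) {1..2 * N})" by auto
  then have "(\<Sum>k=1..2 * Suc N. f k) = f (2 * Suc N) + (f (2 * Suc N - 1) + (\<Sum>k=1..2 * N. f k))" by simp
  with Suc show ?case by (simp add: add_ac)
qed simp

section \<open>Quadratic variation along dyadic partitions\<close>

locale trifractional_process = prob_space M for M :: "'a measure" +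
  fixes H K :: real and Z :: "real \<Rightarrow> 'a \<Rightarrow> real"
  assumes H: "0 < H" "H < 1" and K: "0 < K" "K < 1"
    and Z: "trifractional_brownian_motion M H K Z"
begin

section \<open>The Gaussian space spanned by the process\<close>

definition lin_span :: "('a \<Rightarrow> real) set" where
  "lin_span = {X. \<exists>J c. finite J \<and> J \<subseteq> {0..} \<and> X = (\<lambda>\<omega>. \<Sum>t\<in>J. c t * Z t \<omega>)}"

lemma Z_in_lin_span: "0 \<le> t \<Longrightarrow> Z t \<in> lin_span"
  unfolding lin_span_def by (intro CollectI exI[of _ "{t}"] exI[of _ "\<lambda>_. 1"]) auto

lemma lin_span_scale:
  assumes "X \<in> lin_span"
  shows "(\<lambda>\<omega>. a * X \<omega>) \<in> lin_span"
proof -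
  from assms obtain J c where J: "finite J" "J \<subseteq> {0..}" "X = (\<lambda>\<omega>. \<Sum>t\<in>J. c t * Z t \<omega>)"
    by (auto simp: lin_span_def)
  have "(\<lambda>\<omega>. a * X \<omega>) = (\<lambda>\<omega>. \<Sum>t\<in>J. (a * c t) * Z t \<omega>)"
    by (simp add: J(3) sum_distrib_left mult.assoc)
  then show ?thesis
    unfolding lin_span_def using J(1,2) by (intro CollectI exI[of _ J] exI[of _ "\<lambda>t. a * c t"]) auto
qed

lemma lin_span_add:
  assumes "X \<in> lin_span" "Y \<in> lin_span"
  shows "(\<lambda>\<omega>. X \<omega> + Y \<omega>) \<in> lin_span"
proof -
  from assms(1) obtain J c where J: "finite J" "J \<subseteq> {0..}" "X = (\<lambda>\<omega>. \<Sum>t\<in>J. c t * Z t \<omega>)"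
    by (auto simp: lin_span_def)
  from assms(2) obtain I d where I: "finite I" "I \<subseteq> {0..}" "Y = (\<lambda>\<omega>. \<Sum>t\<in>I. d t * Z t \<omega>)"
    by (auto simp: lin_span_def)
  \<comment> \<open>The two index sets may overlap, so both coefficient families are extended by
    zero to the union.\<close>
  define e where "e t = (if t \<in> J then c t else 0) + (if t \<in> I then d t else 0)" for t
  have "(\<Sum>t\<in>J. c t * Z t \<omega>) = (\<Sum>t\<in>J \<union> I. (if t \<in> J then c t else 0) * Z t \<omega>)" for \<omega>
    using J I by (intro sum.mono_neutral_cong_left) auto
  moreover have "(\<Sum>t\<in>I. d t * Z t \<omega>) = (\<Sum>t\<in>J \<union> I. (if t \<in> I then d t else 0) * Z t \<omega>)" for \<omega>
    using J I by (intro sum.mono_neutral_cong_left) auto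
  ultimately have "(\<lambda>\<omega>. X \<omega> + Y \<omega>) = (\<lambda>\<omega>. \<Sum>t\<in>J \<union> I. e t * Z t \<omega>)"
    unfolding J(3) I(3) e_def by (simp add: distrib_right sum.distrib)
  then show ?thesis
    unfolding lin_span_def using J(1,2) I(1,2) by (intro CollectI exI[of _ "J \<union> I"] exI[of _ e]) auto
qed

lemma lin_span_diff: "X \<in> lin_span \<Longrightarrow> Y \<in> lin_span \<Longrightarrow> (\<lambda>\<omega>. X \<omega> - Y \<omega>) \<in> lin_span"
  using lin_span_add[of X "\<lambda>\<omega>. - 1 * Y \<omega>"] lin_span_scale[of Y "- 1"] by simp

text \<open>Gaussianity is the definition of a Gaussian process. For the mean, singletons come
  first: they make each \<open>Z t\<close> integrable, so that expectation is linear.\<close>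

lemma lin_span_centered_gaussian:
  assumes "X \<in> lin_span"
  shows "centered_gaussian M X"
proof -
  have lin: "gaussian_rv M (\<lambda>\<omega>. \<Sum>t\<in>J. c t * Z t \<omega>)" if "finite J" "J \<subseteq> {0..}" for J c
    using Z that by (auto simp: trifractional_brownian_motion_def gaussian_process_def)
  have Zg: "centered_gaussian M (Z t)" if "0 \<le> t" for t
    using lin[of "{t}" "\<lambda>_. 1"] Z that
    by (auto simp: centered_gaussian_def trifractional_brownian_motion_def)
  from assms obtain J c where J: "finite J" "J \<subseteq> {0..}" "X = (\<lambda>\<omega>. \<Sum>t\<in>J. c t * Z t \<omega>)"
    by (auto simp: lin_span_def)
  have int: "integrable M (Z t)" if "t \<in> J" for t
    using centered_gaussian_integrable_power[OF Zg, of t 1] J that by auto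
  have "expectation X = (\<Sum>t\<in>J. c t * expectation (Z t))"
    unfolding J(3) using int by simp
  also have "\<dots> = 0"
    using Zg J(2) by (intro sum.neutral) (auto simp: centered_gaussian_def)
  finally show ?thesis using lin[OF J(1,2), of c] J(3) by (simp add: centered_gaussian_def)
qed

lemma lin_span_integrable:
  assumes "X \<in> lin_span" "Y \<in> lin_span"
  shows "integrable M (\<lambda>\<omega>. X \<omega> * Y \<omega>)"
  using assms
  by (intro centered_gaussian_wick(1) lin_span_centered_gaussian lin_span_add lin_span_diff)

text \<open>The span is closed under sums and differences, which supplies the Gaussianity of X + Y
  and X - Y required for polarisation.\<close>

lemma lin_span_wick:
  assumes "X \<in> lin_span" "Y \<in> lin_span"
  shows "integrable M (\<lambda>\<omega>. (X \<omega>)^2 * (Y \<omega>)^2)"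
    and "expectation (\<lambda>\<omega>. (X \<omega>)^2 * (Y \<omega>)^2)
       = expectation (\<lambda>\<omega>. (X \<omega>)^2) * expectation (\<lambda>\<omega>. (Y \<omega>)^2) + 2 * (expectation (\<lambda>\<omega>. X \<omega> * Y \<omega>))^2"
  by (rule centered_gaussian_wick(2,3)[OF assms[THEN lin_span_centered_gaussian]
        lin_span_centered_gaussian[OF lin_span_add[OF assms]] lin_span_centered_gaussian[OF lin_span_diff[OF assms]]])+

section \<open>Second moments of the process and its increments\<close>

lemma expectation_Z_mult:
  assumes "0 \<le> s" "0 \<le> t"
  shows "expectation (\<lambda>\<omega>. Z s \<omega> * Z t \<omega>) = trifractional_cov H K s t"
  using Z assms by (auto simp: trifractional_brownian_motion_def covariance_def)

lemma expectation_Z_diff_power2: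
  assumes "0 \<le> s" "0 \<le> t"
  shows "expectation (\<lambda>\<omega>. (Z t \<omega> - Z s \<omega>)^2)
    = trifractional_cov H K t t + trifractional_cov H K s s - 2 * trifractional_cov H K s t"
proof -
  have "(\<lambda>\<omega>. (Z t \<omega> - Z s \<omega>)^2) = (\<lambda>\<omega>. Z t \<omega> * Z t \<omega> + Z s \<omega> * Z s \<omega> - 2 * (Z s \<omega> * Z t \<omega>))"
    by (auto simp: power2_eq_square algebra_simps)
  then show ?thesis
    using assms by (simp add: lin_span_integrable Z_in_lin_span expectation_Z_mult)
qed

definition incr :: "real \<Rightarrow> nat \<Rightarrow> nat \<Rightarrow> 'a \<Rightarrow> real" where
  "incr T n k = (\<lambda>\<omega>. Z (real k * T / 2^n) \<omega> - Z ((real k - 1) * T / 2^n) \<omega>)"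

lemma incr_in_lin_span: "0 \<le> T \<Longrightarrow> 1 \<le> k \<Longrightarrow> incr T n k \<in> lin_span"
  unfolding incr_def by (intro lin_span_diff Z_in_lin_span) auto

text \<open>Self-similarity extracts the mesh size; the remaining factor is the variance over
  [k - 1, k].\<close>

lemma incr_variance:
  assumes "0 < T" "1 \<le> k"
  shows "expectation (\<lambda>\<omega>. (incr T n k \<omega>)^2) = (T / 2^n) powr (2*H*K) *
    (2 * (real k powr (2*H) + (real k - 1) powr (2*H)) powr K
      - 2 powr K * (real k powr (2*H*K) + (real k - 1) powr (2*H*K)))"
proof -
  let ?h = "T / 2^n"
  have nn: "0 \<le> ?h" "0 \<le> real k" "0 \<le> real k - 1" using assms by auto
  have "expectation (\<lambda>\<omega>. (incr T n k \<omega>)^2)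
     = trifractional_cov H K (?h * real k) (?h * real k) + trifractional_cov H K (?h * (real k - 1)) (?h * (real k - 1))
       - 2 * trifractional_cov H K (?h * (real k - 1)) (?h * real k)"
    unfolding incr_def using assms by (subst expectation_Z_diff_power2) (auto simp: mult_ac)
  also have "\<dots> = ?h powr (2*H*K) * (trifractional_cov H K (real k) (real k)
       + trifractional_cov H K (real k - 1) (real k - 1) - 2 * trifractional_cov H K (real k - 1) (real k))"
    unfolding trifractional_cov_scale[OF nn(1,2,2)] trifractional_cov_scale[OF nn(1,3,3)]
      trifractional_cov_scale[OF nn(1,3,2)] by (simp add: algebra_simps)
  also have "trifractional_cov H K (real k) (real k)
       + trifractional_cov H K (real k - 1) (real k - 1) - 2 * trifractional_cov H K (real k - 1) (real k)
     = 2 * (real k powr (2*H) + (real k - 1) powr (2*H)) powr K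
      - 2 powr K * (real k powr (2*H*K) + (real k - 1) powr (2*H*K))"
    unfolding trifractional_cov_same[OF nn(2)] trifractional_cov_same[OF nn(3)]
    by (simp add: trifractional_cov_def algebra_simps)
  finally show ?thesis .
qed

lemma incr_variance_le:
  assumes "0 < T" "1 \<le> k"
  shows "expectation (\<lambda>\<omega>. (incr T n k \<omega>)^2) \<le> 512 * (T / 2^n) powr (2*H*K) * real k powr (2*H*K - 2)"
proof -
  have "2 * (real k powr (2*H) + (real k - 1) powr (2*H)) powr K
      - 2 powr K * (real k powr (2*H*K) + (real k - 1) powr (2*H*K)) \<le> 512 * real k powr (2*H*K - 2)"
  \<comment> \<open>The general estimate starts at \<open>k\<close> = 2; on the first interval the
    left side is \<open>2 - 2 powr K\<close>.\<close>
  proof (cases "k = 1")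
    case True
    have "0 \<le> 2 powr K" by simp
    then have "2 - 2 powr K \<le> 512" by linarith
    then show ?thesis using True by simp
  next
    case False
    then show ?thesis using H K assms by (intro trifractional_increment_bound) auto
  qed
  then have "(T / 2^n) powr (2*H*K) * (2 * (real k powr (2*H) + (real k - 1) powr (2*H)) powr K
      - 2 powr K * (real k powr (2*H*K) + (real k - 1) powr (2*H*K)))
      \<le> (T / 2^n) powr (2*H*K) * (512 * real k powr (2*H*K - 2))"
    by (intro mult_left_mono) auto
  then show ?thesis unfolding incr_variance[OF assms] by (simp add: mult_ac)
qed

section \<open>Dyadic quadratic variation and its moments\<close>

definition qvar :: "real \<Rightarrow> nat \<Rightarrow> 'a \<Rightarrow> real" where
  "qvar T n = (\<lambda>\<omega>. \<Sum>k=1..2^n. (incr T n k \<omega>)^2)"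

lemma qvar_measurable [measurable]:
  assumes "0 \<le> T"
  shows "qvar T n \<in> borel_measurable M"
  unfolding qvar_def using lin_span_centered_gaussian[OF incr_in_lin_span[OF assms]]
  by (intro borel_measurable_sum borel_measurable_power centered_gaussian_measurable) auto

lemma qvar_nonneg: "0 \<le> qvar T n \<omega>"
  by (simp add: qvar_def sum_nonneg)

lemma qvar_moment:
  assumes "0 < T" "even r"
  shows "integrable M (\<lambda>\<omega>. qvar T n \<omega> ^ r)"
    and "expectation (\<lambda>\<omega>. qvar T n \<omega> ^ r) \<le> fact (2 * r) / (2 ^ r * fact r)
      * (512 * (T / 2^n) powr (2*H*K) * (\<Sum>k=1..2^n. real k powr (2*H*K - 2))) ^ r"
proof -
  let ?w = "\<lambda>k. 512 * (T / 2^n) powr (2*H*K) * real k powr (2*H*K - 2)"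
  have *: "finite {1..2^n::nat}" "{1..2^n::nat} \<noteq> {}" by auto
  have g: "centered_gaussian M (incr T n k)" if "k \<in> {1..2^n}" for k
    using assms that by (intro lin_span_centered_gaussian incr_in_lin_span) auto
  have w: "0 < ?w k" "expectation (\<lambda>\<omega>. (incr T n k \<omega>)^2) \<le> ?w k" if "k \<in> {1..2^n}" for k
    using assms that by (auto intro: incr_variance_le)
  show "integrable M (\<lambda>\<omega>. qvar T n \<omega> ^ r)"
    unfolding qvar_def by (rule gaussian_square_sum_moment(1)[where w = ?w, OF * assms(2) g w])
  show "expectation (\<lambda>\<omega>. qvar T n \<omega> ^ r) \<le> fact (2 * r) / (2 ^ r * fact r)
      * (512 * (T / 2^n) powr (2*H*K) * (\<Sum>k=1..2^n. real k powr (2*H*K - 2))) ^ r"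
    unfolding qvar_def sum_distrib_left
    by (rule gaussian_square_sum_moment(2)[where w = ?w, OF * assms(2) g w])
qed

text \<open>The factor 2 matches one step of the normalisation 2^n, so the normalised sums increase
  along every path.\<close>

lemma qvar_le_twice_refined: "qvar T n \<omega> \<le> 2 * qvar T (Suc n) \<omega>"
proof -
  have split: "incr T n k \<omega> = incr T (Suc n) (2 * k - 1) \<omega> + incr T (Suc n) (2 * k) \<omega>" if "1 \<le> k" for k
  proof -
    have "real (2 * k) * T / 2 ^ Suc n = real k * T / 2 ^ n"
      "(real (2 * k - 1) - 1) * T / 2 ^ Suc n = (real k - 1) * T / 2 ^ n"
      "real (2 * k - 1) = real (2 * k) - 1"
      using that by (auto simp: of_nat_diff field_simps)
    then show ?thesis by (simp add: incr_def)
  qed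
  have "qvar T n \<omega> \<le> (\<Sum>k=1..2^n. 2 * ((incr T (Suc n) (2 * k - 1) \<omega>)^2 + (incr T (Suc n) (2 * k) \<omega>)^2))"
    unfolding qvar_def
  proof (intro sum_mono)
    fix k :: nat assume "k \<in> {1..2^n}"
    then have k: "1 \<le> k" by simp
    show "(incr T n k \<omega>)^2 \<le> 2 * ((incr T (Suc n) (2 * k - 1) \<omega>)^2 + (incr T (Suc n) (2 * k) \<omega>)^2)"
      unfolding split[OF k] using sum_squares_bound[of "incr T (Suc n) (2 * k - 1) \<omega>" "incr T (Suc n) (2 * k) \<omega>"]
      by (simp add: power2_sum)
  qed
  also have "\<dots> = 2 * qvar T (Suc n) \<omega>"
    by (simp only: qvar_def power_Suc sum_pairs sum_distrib_left)
  finally show ?thesis .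
qed

section \<open>The regime HK > 1/2\<close>

lemma scaled_qvar_converges_in_Lp:
  assumes T: "0 < T" and HK: "1 / 2 < H * K"
  shows "\<exists>L. non_constant_rv M L \<and> (\<forall>p>1. converges_in_Lp M p (\<lambda>n \<omega>. 2^n * qvar T n \<omega>) L)"
proof -
  \<comment> \<open>The variance bounds sum to order 2^(n \<alpha>), where HK > 1/2 gives \<alpha> >
    0. Then 2^n * 2^(n \<alpha>) * 2^(-2HKn) = 1, so the bound is uniform in n.\<close>
  define \<alpha> where "\<alpha> = 2 * H * K - 1"
  have "H * K < 1 * 1" using H K by (intro mult_strict_mono) auto
  then have \<alpha>: "0 < \<alpha>" "\<alpha> \<le> 1" using HK by (auto simp: \<alpha>_def)
  let ?Q = "\<lambda>n \<omega>. 2^n * qvar T n \<omega>"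
  have mono: "incseq (\<lambda>n. ?Q n \<omega>)" for \<omega>
    using qvar_le_twice_refined[of T _ \<omega>] by (intro incseq_SucI) (simp add: mult.left_commute)
  have var: "2^n * (512 * (T / 2^n) powr (2*H*K) * (\<Sum>k=1..2^n. real k powr (2*H*K - 2)))
      \<le> 512 * T powr (2*H*K) / \<alpha>" for n :: nat
  proof -
    have "(\<Sum>k=1..2^n. real k powr (2*H*K - 2)) \<le> real (2^n) powr \<alpha> / \<alpha>"
      using sum_powr_le[OF \<alpha>, of "2^n"] by (simp add: \<alpha>_def)
    then have "2^n * (512 * (T / 2^n) powr (2*H*K) * (\<Sum>k=1..2^n. real k powr (2*H*K - 2)))
        \<le> 2^n * (512 * (T / 2^n) powr (2*H*K) * (real (2^n) powr \<alpha> / \<alpha>))"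
      by (intro mult_left_mono) auto
    also have "\<dots> = 512 * T powr (2*H*K) / \<alpha> * (2^n * (2^n) powr \<alpha> / (2^n) powr (2*H*K))"
      using T by (simp add: powr_divide mult_ac)
    also have "(2^n * (2^n) powr \<alpha> / (2^n) powr (2*H*K) :: real) = 1"
      by (simp add: \<alpha>_def powr_diff)
    finally show ?thesis by simp
  qed
  have int: "integrable M (\<lambda>\<omega>. ?Q n \<omega> ^ r)" if "even r" for n r
    using qvar_moment(1)[OF T that] by (simp add: power_mult_distrib)
  have bound: "\<exists>B. \<forall>n. expectation (\<lambda>\<omega>. ?Q n \<omega> ^ r) \<le> B" if r: "even r" for r
  proof (intro exI allI)
    fix n
    define c :: real where "c = fact (2 * r) / (2 ^ r * fact r)"
    have "0 \<le> c" by (simp add: c_def)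
    let ?S = "512 * (T / 2^n) powr (2*H*K) * (\<Sum>k=1..2^n. real k powr (2*H*K - 2))"
    have "expectation (\<lambda>\<omega>. ?Q n \<omega> ^ r) = (2^n) ^ r * expectation (\<lambda>\<omega>. qvar T n \<omega> ^ r)"
      by (simp add: power_mult_distrib)
    also have "\<dots> \<le> (2^n) ^ r * (c * ?S ^ r)"
      using qvar_moment(2)[OF T r, of n] by (intro mult_left_mono) (auto simp: c_def)
    also have "\<dots> = c * (2^n * ?S) ^ r" by (simp add: power_mult_distrib)
    also have "\<dots> \<le> c * (512 * T powr (2*H*K) / \<alpha>) ^ r"
      using var[of n] \<open>0 \<le> c\<close> by (intro mult_left_mono power_mono) (auto intro!: mult_nonneg_nonneg sum_nonneg)
    finally show "expectation (\<lambda>\<omega>. ?Q n \<omega> ^ r) \<le> c * (512 * T powr (2*H*K) / \<alpha>) ^ r" .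
  qed
  have meas: "?Q n \<in> borel_measurable M" for n
    using T by (intro borel_measurable_times qvar_measurable) auto
  obtain L where L: "L \<in> borel_measurable M" "AE \<omega> in M. \<forall>n. ?Q n \<omega> \<le> L \<omega>"
    "\<And>p. 1 < p \<Longrightarrow> converges_in_Lp M p ?Q L"
  proof (rule incseq_bounded_moments_converges_in_Lp[of ?Q])
    show "0 \<le> ?Q n \<omega>" for n \<omega> using qvar_nonneg[of T n \<omega>] by simp
  qed (use meas mono int bound in auto)
  have "non_constant_rv M L"
    unfolding non_constant_rv_def
  proof (intro conjI notI L(1))
    assume "\<exists>c. AE \<omega> in M. L \<omega> = c"
    then obtain c where "AE \<omega> in M. L \<omega> = c" by blast
    \<comment> \<open>The term \<open>n\<close> = 0 is (Z T - Z 0)^2. Its expectation is T^(2HK) (2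
      - 2^K), positive because K < 1.\<close>
    with L(2) have "AE \<omega> in M. (incr T 0 1 \<omega>)^2 \<le> c"
    proof eventually_elim
      case (elim \<omega>)
      then have "?Q 0 \<omega> \<le> c" by metis
      then show ?case by (simp add: qvar_def)
    qed
    moreover have "0 < expectation (\<lambda>\<omega>. (incr T 0 1 \<omega>)^2)"
      using T K powr_less_mono[of K 1 2] by (simp add: incr_variance)
    ultimately show False
      using centered_gaussian_unbounded[OF lin_span_centered_gaussian[OF incr_in_lin_span]] T by simp
  qed
  then show ?thesis using L(3) by blast
qed

section \<open>The regime HK < 1/2\<close>

lemma scaled_qvar_not_converges_in_probability:
  assumes T: "0 < T" and HK: "H * K < 1 / 2"
  shows "\<not> converges_in_probability M (\<lambda>n \<omega>. 2 powr (2 * H * K * real n) * qvar T n \<omega>) L"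
proof -
  \<comment> \<open>Increments carrying the square root of the normalisation, so that the sequence
    becomes a plain sum of squares.\<close>
  define V where "V n k = (\<lambda>\<omega>. 2 powr (H * K * real n) * incr T n k \<omega>)" for n k
  define c where "c n j m k = expectation (\<lambda>\<omega>. V n j \<omega> * V m k \<omega>)" for n j m k
  \<comment> \<open>A bound on the variance of \<open>V n k\<close> that does not depend on
    \<open>n\<close>. It is summable because HK < 1/2 makes the exponent smaller than -1.\<close>
  define w where "w k = 512 * T powr (2*H*K) * real k powr (2*H*K - 2)" for k :: nat
  define W where "W = suminf w"
  \<comment> \<open>By Wick's formula the covariance of the n-th and m-th terms of the sequence is
    \<open>2 * S n m\<close>.\<close>
  define S where "S n m = (\<Sum>j=1..2^n. \<Sum>k=1..2^m. (c n j m k)^2)" for n m :: nat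
  \<comment> \<open>The variance of \<open>V n 1\<close>, the same at every level by
    self-similarity.\<close>
  define v where "v = T powr (2*H*K) * (2 - 2 powr K)"
  let ?a = "\<lambda>n \<omega>. 2 powr (2 * H * K * real n) * qvar T n \<omega>"
  have pw: "(2 powr (H * K * real n))^2 = 2 powr (2 * H * K * real n)" for n
    by (simp add: power2_eq_square powr_add[symmetric] mult.assoc)
  have scale: "2 powr (2 * H * K * real n) * (T / 2^n) powr (2*H*K) = T powr (2*H*K)" for n
    using T by (simp add: powr_divide powr_realpow[symmetric] powr_powr mult.commute)
  have v: "0 < v" using T K powr_less_mono[of K 1 2] by (simp add: v_def)
  have V: "V n k \<in> lin_span" if "1 \<le> k" for n k
    unfolding V_def using T that by (intro lin_span_scale incr_in_lin_span) auto
  have a_sum: "?a n \<omega> = (\<Sum>k=1..2^n. (V n k \<omega>)^2)" for n \<omega>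
    by (simp add: qvar_def V_def power_mult_distrib pw sum_distrib_left)
  have var: "c n k n k = 2 powr (2 * H * K * real n) * expectation (\<lambda>\<omega>. (incr T n k \<omega>)^2)" for n k
  proof -
    have "c n k n k = expectation (\<lambda>\<omega>. (2 powr (H * K * real n))^2 * (incr T n k \<omega>)^2)"
      by (simp add: c_def V_def power2_eq_square mult_ac)
    then show ?thesis by (simp add: pw)
  qed
  have var1: "c n 1 n 1 = v" for n
  proof -
    have "c n 1 n 1 = (2 powr (2 * H * K * real n) * (T / 2^n) powr (2*H*K)) * (2 - 2 powr K)"
      using T by (simp add: var incr_variance)
    then show ?thesis unfolding scale v_def .
  qed
  have var_le: "c n k n k \<le> w k" if "1 \<le> k" for n k
  proof -
    have "c n k n k \<le> 2 powr (2 * H * K * real n) * (512 * (T / 2^n) powr (2*H*K) * real k powr (2*H*K - 2))"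
      unfolding var using incr_variance_le[OF T that] by (intro mult_left_mono) auto
    also have "\<dots> = 512 * (2 powr (2 * H * K * real n) * (T / 2^n) powr (2*H*K)) * real k powr (2*H*K - 2)"
      by (simp add: mult_ac)
    finally show ?thesis unfolding scale w_def .
  qed
  have w0: "0 \<le> w k" for k by (simp add: w_def)
  have w_summable: "summable w"
    unfolding w_def using HK by (intro summable_mult) (simp add: summable_real_powr_iff)
  \<comment> \<open>Cauchy-Schwarz gives a bound free of \<open>n\<close> and \<open>m\<close> and
    summable in \<open>k\<close>, as needed for exchanging limit and sum.\<close>
  have c_sq: "(c n j m k)^2 \<le> w j * w k" if "1 \<le> j" "1 \<le> k" for n j m k
  proof -
    have meas: "V n k \<in> borel_measurable M" if "1 \<le> k" for n k
      using lin_span_centered_gaussian[OF V[OF that]] by measurable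
    have "(c n j m k)^2 \<le> c n j n j * c m k m k"
      using expectation_mult_power2_le[of "V n j" "V m k"] meas that lin_span_integrable[OF V V]
      by (simp add: c_def power2_eq_square)
    also have "\<dots> \<le> w j * w k"
      using var_le that w0 by (intro mult_mono) (auto simp: c_def)
    finally show ?thesis .
  qed
  \<comment> \<open>Expanding both increments gives four covariances, each between a fixed time and
    a time shrinking like 2^(-m).\<close>
  have c_lim: "(\<lambda>m. c n j m k) \<longlonglongrightarrow> 0" if "1 \<le> j" "1 \<le> k" for n j k
  proof -
    let ?C = "\<lambda>t x m. 2 powr (H * K * real m) * trifractional_cov H K t (x / 2^m)"
    let ?t = "real j * T / 2^n" and ?s = "(real j - 1) * T / 2^n"
    let ?x = "real k * T" and ?y = "(real k - 1) * T"
    have nn: "0 \<le> ?t" "0 \<le> ?s" "0 \<le> ?x" "0 \<le> ?y" using T that by auto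
    have "c n j m k = 2 powr (H * K * real n) * (?C ?t ?x m - ?C ?t ?y m - ?C ?s ?x m + ?C ?s ?y m)" for m
    proof -
      have nm: "0 \<le> ?x / 2^m" "0 \<le> ?y / 2^m" using nn by auto
      have "(\<lambda>\<omega>. V n j \<omega> * V m k \<omega>) = (\<lambda>\<omega>. 2 powr (H * K * real n) * (2 powr (H * K * real m) *
          (Z ?t \<omega> * Z (?x / 2^m) \<omega> - Z ?t \<omega> * Z (?y / 2^m) \<omega> - Z ?s \<omega> * Z (?x / 2^m) \<omega> + Z ?s \<omega> * Z (?y / 2^m) \<omega>)))"
        by (auto simp: V_def incr_def algebra_simps)
      then show ?thesis
        unfolding c_def
        by (simp add: lin_span_integrable Z_in_lin_span nn nm expectation_Z_mult distrib_left right_diff_distrib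
              del: times_divide_eq_left times_divide_eq_right)
    qed
    moreover have "(\<lambda>m. 2 powr (H * K * real n) * (?C ?t ?x m - ?C ?t ?y m - ?C ?s ?x m + ?C ?s ?y m))
        \<longlonglongrightarrow> 2 powr (H * K * real n) * (0 - 0 - 0 + 0)"
      using H K nn by (intro tendsto_intros scaled_trifractional_cov_tendsto_0) auto
    ultimately show ?thesis by simp
  qed
  have S_lim: "(\<lambda>m. S n m) \<longlonglongrightarrow> 0" for n
  proof -
    have "(\<lambda>m. \<Sum>k=1..2^m. (c n j m k)^2) \<longlonglongrightarrow> 0" if j: "1 \<le> j" for j
    proof -
      \<comment> \<open>The number of summands grows with \<open>m\<close>; extending by zero turns
        the sum into a series to which Tannery's theorem applies.\<close>
      let ?f = "\<lambda>k m. if k \<in> {1..2^m} then (c n j m k)^2 else 0"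
      have "(\<lambda>m. suminf (\<lambda>k. ?f k m)) \<longlonglongrightarrow> suminf (\<lambda>k. 0)"
      proof (rule tannerys_theorem[where M = "\<lambda>k. w j * w k", THEN conjunct2, THEN conjunct2])
        fix k
        show "(\<lambda>m. ?f k m) \<longlonglongrightarrow> 0"
        proof (cases "1 \<le> k")
          case True
          have "(\<lambda>m. (c n j m k)^2) \<longlonglongrightarrow> 0"
            using tendsto_power[OF c_lim[OF j True, of n], of 2] by simp
          then show ?thesis
            by (rule Lim_null_comparison[rotated]) auto
        qed auto
      next
        show "\<forall>\<^sub>F (k, m) in sequentially \<times>\<^sub>F sequentially. norm (?f k m) \<le> w j * w k"
          using c_sq[OF j] w0 by (intro always_eventually) auto
        show "summable (\<lambda>k. w j * w k)" using w_summable by (rule summable_mult)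
      qed auto
      moreover have "suminf (\<lambda>k. ?f k m) = (\<Sum>k=1..2^m. (c n j m k)^2)" for m
        by (subst suminf_finite[of "{1..2^m}"]) auto
      ultimately show ?thesis by simp
    qed
    then have "(\<lambda>m. \<Sum>j=1..2^n. \<Sum>k=1..2^m. (c n j m k)^2) \<longlonglongrightarrow> (\<Sum>j=1..2^n::nat. 0)"
      by (intro tendsto_sum) auto
    then show ?thesis by (simp add: S_def)
  qed
  \<comment> \<open>Only the term j = k = 1 is kept: the increment next to time 0 alone prevents the
    variance from vanishing.\<close>
  have S_diag: "v^2 \<le> S n n" for n
  proof -
    have "v^2 \<le> (\<Sum>k=1..2^n. (c n 1 n k)^2)"
      using member_le_sum[of 1 "{1..2^n}" "\<lambda>k. (c n 1 n k)^2"] var1[of n] by simp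
    also have "\<dots> \<le> S n n"
      unfolding S_def
      by (rule member_le_sum[of 1 "{1..2^n}" "\<lambda>j. \<Sum>k=1..2^n. (c n j n k)^2"]) (auto intro: sum_nonneg)
    finally show ?thesis .
  qed
  define A where "A n = (\<Sum>j=1..2^n. c n j n j)" for n :: nat
  have prod: "?a n \<omega> * ?a m \<omega> = (\<Sum>j=1..2^n. \<Sum>k=1..2^m. (V n j \<omega>)^2 * (V m k \<omega>)^2)" for n m \<omega>
    unfolding a_sum by (rule sum_product)
  have prod_int: "integrable M (\<lambda>\<omega>. ?a n \<omega> * ?a m \<omega>)" for n m
    unfolding prod using lin_span_wick(1)[OF V V] by (intro Bochner_Integration.integrable_sum) auto
  have prod_exp: "expectation (\<lambda>\<omega>. ?a n \<omega> * ?a m \<omega>) = A n * A m + 2 * S n m" for n m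
  proof -
    have int: "integrable M (\<lambda>\<omega>. (V n j \<omega>)^2 * (V m k \<omega>)^2)" if "j \<in> {1..2^n}" "k \<in> {1..2^m}" for j k
      using lin_span_wick(1)[OF V V] that by simp
    have "expectation (\<lambda>\<omega>. ?a n \<omega> * ?a m \<omega>)
        = (\<Sum>j=1..2^n. expectation (\<lambda>\<omega>. \<Sum>k=1..2^m. (V n j \<omega>)^2 * (V m k \<omega>)^2))"
      unfolding prod
      by (intro Bochner_Integration.integral_sum Bochner_Integration.integrable_sum int)
    also have "\<dots> = (\<Sum>j=1..2^n. \<Sum>k=1..2^m. expectation (\<lambda>\<omega>. (V n j \<omega>)^2 * (V m k \<omega>)^2))"
      by (intro sum.cong refl Bochner_Integration.integral_sum int)
    also have "\<dots> = (\<Sum>j=1..2^n. \<Sum>k=1..2^m. c n j n j * c m k m k + 2 * (c n j m k)^2)"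
    proof (intro sum.cong refl)
      fix j k :: nat assume "j \<in> {1..2^n}" "k \<in> {1..2^m}"
      then show "expectation (\<lambda>\<omega>. (V n j \<omega>)^2 * (V m k \<omega>)^2) = c n j n j * c m k m k + 2 * (c n j m k)^2"
        using lin_span_wick(2)[OF V V, of j k n m] by (simp add: c_def power2_eq_square)
    qed
    also have "\<dots> = A n * A m + 2 * S n m"
      unfolding A_def sum_product by (simp only: S_def sum.distrib sum_distrib_left)
    finally show ?thesis .
  qed
  \<comment> \<open>The variances \<open>2 * S n n\<close> and \<open>2 * S m m\<close>, minus twice
    the covariance, plus the squared difference of the means \<open>A n\<close> and
    \<open>A m\<close>.\<close>
  have dist: "expectation (\<lambda>\<omega>. (?a n \<omega> - ?a m \<omega>)^2) = (A n - A m)^2 + 2 * S n n + 2 * S m m - 4 * S n m" for n m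
  proof -
    have "(\<lambda>\<omega>. (?a n \<omega> - ?a m \<omega>)^2) = (\<lambda>\<omega>. ?a n \<omega> * ?a n \<omega> + ?a m \<omega> * ?a m \<omega> - 2 * (?a n \<omega> * ?a m \<omega>))"
      by (auto simp: power2_eq_square algebra_simps)
    then have "expectation (\<lambda>\<omega>. (?a n \<omega> - ?a m \<omega>)^2) = expectation (\<lambda>\<omega>. ?a n \<omega> * ?a n \<omega>)
        + expectation (\<lambda>\<omega>. ?a m \<omega> * ?a m \<omega>) - 2 * expectation (\<lambda>\<omega>. ?a n \<omega> * ?a m \<omega>)"
      using prod_int by (simp del: mult_cancel_left mult.assoc)
    then show ?thesis unfolding prod_exp by (simp add: power2_eq_square algebra_simps)
  qed
  have int4: "integrable M (\<lambda>\<omega>. ?a n \<omega> ^ 4)" for n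
    using qvar_moment(1)[OF T, of 4 n] by (simp add: power_mult_distrib)
  \<comment> \<open>Using \<open>w\<close> as the weights makes the bound uniform in
    \<open>n\<close>, as its partial sums stay below \<open>W\<close>.\<close>
  have bound4: "expectation (\<lambda>\<omega>. ?a n \<omega> ^ 4) \<le> fact (2 * 4) / (2 ^ 4 * fact 4) * W ^ 4" for n
    unfolding a_sum
  proof (rule order_trans[OF gaussian_square_sum_moment(2)[where w = w]])
    show "centered_gaussian M (V n i)" if "i \<in> {1..2^n}" for i
      using V that by (intro lin_span_centered_gaussian) auto
    show "0 < w i" if "i \<in> {1..2^n}" for i using T that by (simp add: w_def)
    show "expectation (\<lambda>\<omega>. (V n i \<omega>)^2) \<le> w i" if "i \<in> {1..2^n}" for i
      using var_le[of i n] that by (simp add: c_def power2_eq_square)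
    have "sum w {1..2^n} \<le> W"
      unfolding W_def using w_summable w0 by (intro sum_le_suminf) auto
    then show "fact (2 * 4) / (2 ^ 4 * fact 4) * (sum w {1..2^n}) ^ 4 \<le> fact (2 * 4) / (2 ^ 4 * fact 4) * W ^ 4"
      using w0 by (intro mult_left_mono power_mono sum_nonneg) auto
  qed auto
  have sep: "\<forall>\<^sub>F m in sequentially. 2 * v^2 \<le> expectation (\<lambda>\<omega>. (?a n \<omega> - ?a m \<omega>)^2)" for n
  proof -
    have "\<forall>\<^sub>F m in sequentially. S n m < v^2 / 2"
      using S_lim[of n] v by (intro order_tendstoD) auto
    then show ?thesis
    proof eventually_elim
      case (elim m)
      \<comment> \<open>The distance is at least 2 v^2 + 2 v^2 - 4 * (v^2 / 2) = 2 v^2.\<close>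
      then show ?case
        unfolding dist using S_diag[of n] S_diag[of m] zero_le_power2[of "A n - A m"] by linarith
    qed
  qed
  show ?thesis
  proof (rule not_converges_in_probability[OF _ _ int4 bound4 v sep])
    show "?a n \<in> borel_measurable M" for n
      using T by (intro borel_measurable_times qvar_measurable) auto
    show "0 \<le> ?a n \<omega>" for n \<omega> using qvar_nonneg[of T n \<omega>] by simp
  qed
qed

end

theorem theorem2p4:
  fixes M :: "'a measure" and H K T :: real and Z :: "real \<Rightarrow> 'a \<Rightarrow> real"
  assumes "prob_space M"
    and "0 < H" "H < 1" "0 < K" "K < 1" "0 < T"
    and "trifractional_brownian_motion M H K Z"
  shows "(H * K < 1/2 \<longrightarrow>
      \<not> (\<exists>L. converges_in_probability M
            (\<lambda>n \<omega>. 2 powr (2 * H * K * real n) *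
               (\<Sum>k=1..2^n. (Z (real k * T / 2^n) \<omega> - Z ((real k - 1) * T / 2^n) \<omega>)^2)) L))
    \<and> (H * K > 1/2 \<longrightarrow>
      (\<exists>L. non_constant_rv M L \<and>
         (\<forall>p>1. converges_in_Lp M p
            (\<lambda>n \<omega>. 2 ^ n *
               (\<Sum>k=1..2^n. (Z (real k * T / 2^n) \<omega> - Z ((real k - 1) * T / 2^n) \<omega>)^2)) L)))"
proof -
  interpret trifractional_process M H K Z
    using assms by (simp add: trifractional_process_def trifractional_process_axioms_def)
  show ?thesis
    using scaled_qvar_not_converges_in_probability[OF assms(6)] scaled_qvar_converges_in_Lp[OF assms(6)]
    unfolding qvar_def incr_def by blast
qed

end
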